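(* For every prime $p$, the groups $\mathbb{Z}_p$ and $\mathbb{R}/\mathbb{Z}$ are not spectrally independent.
   Context: For a compact group $G$ with probability Haar measure $m_G$, a symmetric Borel probability measure $\mu$ on $G$ has the spectral gap property if the operator norm of $(T_\mu f)(x)=\int_G f(g^{-1}x)\,d\mu(g)$ on the orthogonal complement of the constants in $L^2(G,m_G)$ is strictly less than $1$; a symmetric $G$-valued random variable has the spectral gap property if its law does. Two compact groups $G_1,G_2$ are spectrally independent if every symmetric $G_1\times G_2$-valued random variable $(X,Y)$ for which both $X$ and $Y$ have the spectral gap property has itself the spectral gap property. *)

theory Defs
  imports "HOL-Probability.Probability" "HOL-Algebra.Coset"
begin

section \<open>Compact groups and Haar measure\<close>

text \<open>A topological group is given by a group \<open>G\<close> together with a topology \<open>T\<close> on its carrier.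
  The definitions below are total but meant for pairs satisfying \<open>compact_group\<close>.\<close>

locale compact_group = group G for G (structure) and T +
  assumes topspace_eq: "topspace T = carrier G"
    and compact: "compact_space T"
    and Hausdorff: "Hausdorff_space T"
    and continuous_mult: "continuous_map (prod_topology T T) T (\<lambda>(x, y). x \<otimes> y)"
    and continuous_inv: "continuous_map T T (\<lambda>x. inv x)"

definition borel_of :: "'a topology \<Rightarrow> 'a measure" where
  "borel_of T = sigma (topspace T) {U. openin T U}"

text \<open>Inner regularity is automatic for metrizable \<open>T\<close>; in general it is part of the
  characterization of Haar measure.\<close>

definition is_haar_prob :: "'a monoid \<Rightarrow> 'a topology \<Rightarrow> 'a measure \<Rightarrow> bool" where
  "is_haar_prob G T m \<longleftrightarrow>
     prob_space m \<and> sets m = sets (borel_of T) \<and>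
     (\<forall>g\<in>carrier G. distr m (borel_of T) (\<lambda>x. g \<otimes>\<^bsub>G\<^esub> x) = m) \<and>
     (\<forall>A\<in>sets m. emeasure m A = (SUP K\<in>{K. compactin T K \<and> K \<subseteq> A}. emeasure m K))"

text \<open>On a compact group there is exactly one such measure, so the choice is only nominal.\<close>

definition haar_prob :: "'a monoid \<Rightarrow> 'a topology \<Rightarrow> 'a measure" where
  "haar_prob G T = (SOME m. is_haar_prob G T m)"


section \<open>Spectral gap\<close>

text \<open>Elements of \<open>L\<^sup>2(m)\<close> are represented by square-integrable Borel functions. By Fubini and
  translation invariance of Haar measure, on a second countable compact group the averaging operator
  below respects equality almost everywhere and maps \<open>L\<^sup>2\<close> into itself as a contraction.\<close>

definition L2 :: "'a measure \<Rightarrow> ('a \<Rightarrow> complex) set" where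
  "L2 m = {f \<in> borel_measurable m. integrable m (\<lambda>x. (cmod (f x))\<^sup>2)}"

definition L2_norm :: "'a measure \<Rightarrow> ('a \<Rightarrow> complex) \<Rightarrow> real" where
  "L2_norm m f = sqrt (LINT x|m. (cmod (f x))\<^sup>2)"

definition L2_inner :: "'a measure \<Rightarrow> ('a \<Rightarrow> complex) \<Rightarrow> ('a \<Rightarrow> complex) \<Rightarrow> complex" where
  "L2_inner m f g = (LINT x|m. f x * cnj (g x))"

definition constants_perp :: "'a measure \<Rightarrow> ('a \<Rightarrow> complex) set" where
  "constants_perp m = {f \<in> L2 m. \<forall>c. L2_inner m f (\<lambda>_. c) = 0}"

definition averaging_op :: "'a monoid \<Rightarrow> 'a measure \<Rightarrow> ('a \<Rightarrow> complex) \<Rightarrow> 'a \<Rightarrow> complex" where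
  "averaging_op G \<mu> f x = (LINT g|\<mu>. f (inv\<^bsub>G\<^esub> g \<otimes>\<^bsub>G\<^esub> x))"

definition op_norm_on ::
    "'a measure \<Rightarrow> ('a \<Rightarrow> complex) set \<Rightarrow> (('a \<Rightarrow> complex) \<Rightarrow> 'a \<Rightarrow> complex) \<Rightarrow> ereal" where
  "op_norm_on m V A = (SUP f\<in>{f \<in> V. L2_norm m f \<le> 1}. ereal (L2_norm m (A f)))"

definition symmetric_borel_prob :: "'a monoid \<Rightarrow> 'a topology \<Rightarrow> 'a measure \<Rightarrow> bool" where
  "symmetric_borel_prob G T \<mu> \<longleftrightarrow>
     prob_space \<mu> \<and> sets \<mu> = sets (borel_of T) \<and> distr \<mu> (borel_of T) (\<lambda>x. inv\<^bsub>G\<^esub> x) = \<mu>"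

definition spectral_gap :: "'a monoid \<Rightarrow> 'a topology \<Rightarrow> 'a measure \<Rightarrow> bool" where
  "spectral_gap G T \<mu> \<longleftrightarrow>
     symmetric_borel_prob G T \<mu> \<and>
     op_norm_on (haar_prob G T) (constants_perp (haar_prob G T)) (averaging_op G \<mu>) < 1"

definition symmetric_rv :: "'a monoid \<Rightarrow> 'a topology \<Rightarrow> 'w measure \<Rightarrow> ('w \<Rightarrow> 'a) \<Rightarrow> bool" where
  "symmetric_rv G T M X \<longleftrightarrow>
     prob_space M \<and> X \<in> measurable M (borel_of T) \<and>
     symmetric_borel_prob G T (distr M (borel_of T) X)"

definition spectral_gap_rv :: "'a monoid \<Rightarrow> 'a topology \<Rightarrow> 'w measure \<Rightarrow> ('w \<Rightarrow> 'a) \<Rightarrow> bool" where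
  "spectral_gap_rv G T M X \<longleftrightarrow>
     symmetric_rv G T M X \<and> spectral_gap G T (distr M (borel_of T) X)"

text \<open>All conditions depend only on the law of \<open>(X, Y)\<close>, which is realized by the identity map on
  the product type; hence it is no loss to let the probability spaces \<open>M\<close> live on that type.\<close>

definition spectrally_independent ::
    "'a monoid \<Rightarrow> 'a topology \<Rightarrow> 'b monoid \<Rightarrow> 'b topology \<Rightarrow> bool" where
  "spectrally_independent G S H T \<longleftrightarrow>
     (\<forall>(M :: ('a \<times> 'b) measure) X Y.
        symmetric_rv (G \<times>\<times> H) (prod_topology S T) M (\<lambda>\<omega>. (X \<omega>, Y \<omega>)) \<longrightarrow>
        spectral_gap_rv G S M X \<longrightarrow> spectral_gap_rv H T M Y \<longrightarrow>
        spectral_gap_rv (G \<times>\<times> H) (prod_topology S T) M (\<lambda>\<omega>. (X \<omega>, Y \<omega>)))"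


section \<open>The \<open>p\<close>-adic integers\<close>

text \<open>The additive group of the inverse limit of the rings \<open>\<int>/p\<^sup>n\<int>\<close>, with residues represented in
  \<open>{0..<p\<^sup>n}\<close>, topologized as a subspace of the product of discrete spaces.\<close>

definition padic_carrier :: "nat \<Rightarrow> (nat \<Rightarrow> int) set" where
  "padic_carrier p =
     {x. \<forall>n. x n \<in> {0..<int p ^ n} \<and> x (Suc n) mod int p ^ n = x n}"

definition padic_group :: "nat \<Rightarrow> (nat \<Rightarrow> int) monoid" where
  "padic_group p = \<lparr>carrier = padic_carrier p,
     monoid.mult = (\<lambda>x y n. (x n + y n) mod int p ^ n), one = (\<lambda>_. 0)\<rparr>"

definition padic_topology :: "nat \<Rightarrow> (nat \<Rightarrow> int) topology" where
  "padic_topology p =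
     subtopology (product_topology (\<lambda>_. discrete_topology UNIV) UNIV) (padic_carrier p)"

lemma padic_compact_group:
  assumes "prime p"
  shows "compact_group (padic_group p) (padic_topology p)"
proof -
  let ?G = "padic_group p" and ?C = "padic_carrier p"
  let ?P = "product_topology (\<lambda>_::nat. discrete_topology (UNIV :: int set)) UNIV"
  have p: "p > 0" using assms by (simp add: prime_gt_0_nat)
  have mod_mod: "a mod int p ^ Suc n mod int p ^ n = a mod int p ^ n" for a n
    by (rule mod_mod_cancel) (simp add: le_imp_power_dvd)
  have coherent: "x (Suc n) mod int p ^ n = x n" if "x \<in> ?C" for x n
    using that by (simp add: padic_carrier_def)
  have mult_closed: "(\<lambda>n. (x n + y n) mod int p ^ n) \<in> ?C" if "x \<in> ?C" "y \<in> ?C" for x y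
  proof -
    have "(x (Suc n) + y (Suc n)) mod int p ^ n = (x n + y n) mod int p ^ n" for n
      using mod_add_eq[of "x (Suc n)" "int p ^ n" "y (Suc n)"] coherent[OF that(1)] coherent[OF that(2)]
      by simp
    then show ?thesis using p by (simp add: padic_carrier_def mod_mod del: power_Suc)
  qed
  have neg_closed: "(\<lambda>n. (- x n) mod int p ^ n) \<in> ?C" if "x \<in> ?C" for x
  proof -
    have "(- x (Suc n)) mod int p ^ n = (- x n) mod int p ^ n" for n
      using mod_minus_eq[of "x (Suc n)" "int p ^ n"] coherent[OF that] by simp
    then show ?thesis using p by (simp add: padic_carrier_def mod_mod del: power_Suc)
  qed
  have range: "x n mod int p ^ n = x n" if "x \<in> ?C" for x n
    using that by (simp add: padic_carrier_def)
  interpret group ?G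
  proof (rule groupI)
    fix x assume x: "x \<in> carrier ?G"
    show "\<exists>y\<in>carrier ?G. y \<otimes>\<^bsub>?G\<^esub> x = \<one>\<^bsub>?G\<^esub>"
      using neg_closed[of x] x
      by (intro bexI[of _ "\<lambda>n. (- x n) mod int p ^ n"])
         (auto simp: padic_group_def mod_add_left_eq)
  next
    fix x y z
    show "x \<otimes>\<^bsub>?G\<^esub> y \<otimes>\<^bsub>?G\<^esub> z = x \<otimes>\<^bsub>?G\<^esub> (y \<otimes>\<^bsub>?G\<^esub> z)"
      by (simp add: padic_group_def mod_simps add.assoc)
  next
    show "\<one>\<^bsub>?G\<^esub> \<in> carrier ?G"
      using p by (simp add: padic_group_def padic_carrier_def)
  next
    fix x y assume "x \<in> carrier ?G" "y \<in> carrier ?G"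
    then show "x \<otimes>\<^bsub>?G\<^esub> y \<in> carrier ?G"
      using mult_closed by (simp add: padic_group_def)
  next
    fix x assume "x \<in> carrier ?G"
    then show "\<one>\<^bsub>?G\<^esub> \<otimes>\<^bsub>?G\<^esub> x = x"
      using range by (simp add: padic_group_def)
  qed
  have inv_eq: "inv\<^bsub>?G\<^esub> x = (\<lambda>n. (- x n) mod int p ^ n)" if "x \<in> ?C" for x
    using that neg_closed[OF that]
    by (intro inv_equality) (auto simp: padic_group_def mod_add_left_eq)
  have top: "topspace (padic_topology p) = ?C"
    by (simp add: padic_topology_def)
  have cont_proj: "continuous_map (padic_topology p) (discrete_topology UNIV) (\<lambda>x. x n)" for n
    unfolding padic_topology_def
    by (intro continuous_map_from_subtopology continuous_map_product_projection) auto
  have cont_op: "continuous_map X (discrete_topology UNIV) (\<lambda>z. h (f z) (g z))"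
    if "continuous_map X (discrete_topology UNIV) f" "continuous_map X (discrete_topology UNIV) g"
    for X :: "'x topology" and f g :: "'x \<Rightarrow> int" and h :: "int \<Rightarrow> int \<Rightarrow> int"
  proof -
    have "continuous_map X (prod_topology (discrete_topology UNIV) (discrete_topology UNIV))
            (\<lambda>z. (f z, g z))"
      using that by (simp add: continuous_map_pairwise o_def)
    moreover have "continuous_map (prod_topology (discrete_topology UNIV) (discrete_topology UNIV))
            (discrete_topology UNIV) (\<lambda>(a, b). h a b)"
      by (subst prod_topology_discrete_topology [symmetric]) simp
    ultimately show ?thesis
      by (auto dest: continuous_map_compose simp: o_def)
  qed
  have "compactin ?P (Pi\<^sub>E UNIV (\<lambda>n. {0..<int p ^ n}))"
    by (simp add: compactin_PiE compactin_discrete_topology)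
  moreover have "closedin ?P ?C"
  proof -
    have "?C = (\<Inter>n. {x \<in> topspace ?P. x n \<in> {0..<int p ^ n}}
                   \<inter> {x \<in> topspace ?P. x (Suc n) mod int p ^ n - x n \<in> {0}})"
      by (auto simp: padic_carrier_def)
    also have "closedin ?P \<dots>"
    proof (intro closedin_Inter closedin_Int; clarsimp?)
      fix n
      have c: "continuous_map ?P (discrete_topology UNIV) (\<lambda>x. x n)" for n
        by (rule continuous_map_product_projection) auto
      show "closedin ?P ({x. 0 \<le> x n \<and> x n < int p ^ n} \<inter> {x. x (Suc n) mod int p ^ n = x n})"
        using closedin_Int[OF closedin_continuous_map_preimage[OF c[of n], of "{0..<int p ^ n}"]
            closedin_continuous_map_preimage[OF cont_op[OF c[of "Suc n"] c[of n],
                of "\<lambda>a b. a mod int p ^ n - b"], of "{0}"]]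
        by simp
    qed
    finally show ?thesis .
  qed
  moreover have "?C \<subseteq> Pi\<^sub>E UNIV (\<lambda>n. {0..<int p ^ n})"
    by (auto simp: padic_carrier_def)
  ultimately have "compactin ?P ?C"
    using closed_compactin by blast
  then have comp: "compact_space (padic_topology p)"
    unfolding padic_topology_def by (rule compact_space_subtopology)
  have haus: "Hausdorff_space (padic_topology p)"
    unfolding padic_topology_def
    by (intro Hausdorff_space_subtopology) (simp add: Hausdorff_space_product_topology)
  have into: "continuous_map X (padic_topology p) f"
    if "\<And>n. continuous_map X (discrete_topology UNIV) (\<lambda>z. f z n)" "f \<in> topspace X \<rightarrow> ?C"
    for X :: "'x topology" and f
    using that by (auto simp: padic_topology_def continuous_map_in_subtopology
        continuous_map_componentwise_UNIV)
  have mult: "continuous_map (prod_topology (padic_topology p) (padic_topology p))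
                (padic_topology p) (\<lambda>(x, y). x \<otimes>\<^bsub>?G\<^esub> y)"
  proof (rule into)
    fix n
    have f: "continuous_map (prod_topology (padic_topology p) (padic_topology p))
               (discrete_topology UNIV) (\<lambda>z. fst z n)"
      using continuous_map_compose[OF continuous_map_fst cont_proj[of n]] by (simp add: o_def)
    have s: "continuous_map (prod_topology (padic_topology p) (padic_topology p))
               (discrete_topology UNIV) (\<lambda>z. snd z n)"
      using continuous_map_compose[OF continuous_map_snd cont_proj[of n]] by (simp add: o_def)
    show "continuous_map (prod_topology (padic_topology p) (padic_topology p))
            (discrete_topology UNIV) (\<lambda>z. (case z of (x, y) \<Rightarrow> x \<otimes>\<^bsub>?G\<^esub> y) n)"
      using cont_op[OF f s, of "\<lambda>a b. (a + b) mod int p ^ n"]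
      by (simp add: padic_group_def case_prod_unfold)
  qed (use mult_closed in \<open>auto simp: top padic_group_def\<close>)
  have "continuous_map (padic_topology p) (padic_topology p) (\<lambda>x n. (- x n) mod int p ^ n)"
    using neg_closed cont_op[OF cont_proj cont_proj, of "\<lambda>a b. (- a) mod int p ^ _"]
    by (intro into) (auto simp: top)
  then have inverse: "continuous_map (padic_topology p) (padic_topology p) (\<lambda>x. inv\<^bsub>?G\<^esub> x)"
    by (rule continuous_map_eq) (simp add: top inv_eq)
  show ?thesis
    by unfold_locales (use top comp haus mult inverse in \<open>auto simp: padic_group_def\<close>)
qed


section \<open>The circle\<close>

definition real_group :: "real monoid" where
  "real_group = \<lparr>carrier = UNIV, monoid.mult = (+), one = 0\<rparr>"

definition circle_group :: "real set monoid" where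
  "circle_group = real_group Mod \<int>"

definition circle_proj :: "real \<Rightarrow> real set" where
  "circle_proj t = \<int> #>\<^bsub>real_group\<^esub> t"

definition circle_topology :: "real set topology" where
  "circle_topology = topology (\<lambda>U. U \<subseteq> carrier circle_group \<and> open (circle_proj -` U))"

lemma openin_circle_topology:
  "openin circle_topology U \<longleftrightarrow> U \<subseteq> carrier circle_group \<and> open (circle_proj -` U)"
proof -
  have "istopology (\<lambda>U. U \<subseteq> carrier circle_group \<and> open (circle_proj -` U))"
    unfolding istopology_def by (auto simp: vimage_Union)
  then show ?thesis
    by (simp add: circle_topology_def topology_inverse')
qed

lemma circle_proj_eq: "circle_proj t = {t + of_int k |k. True}"
  by (auto simp: circle_proj_def r_coset_def real_group_def Ints_def add.commute)

lemma circle_proj_eq_iff: "circle_proj s = circle_proj t \<longleftrightarrow> s - t \<in> \<int>"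
proof
  assume "circle_proj s = circle_proj t"
  moreover have "s \<in> circle_proj s"
    unfolding circle_proj_eq by (auto intro: exI[of _ 0])
  ultimately show "s - t \<in> \<int>"
    by (auto simp: circle_proj_eq)
next
  assume "s - t \<in> \<int>"
  then obtain k where k: "s = t + of_int k"
    by (metis Ints_cases add.commute diff_add_cancel)
  have "t + of_int j = s + of_int (j - k)" "s + of_int j = t + of_int (j + k)" for j
    using k by auto
  then show "circle_proj s = circle_proj t"
    unfolding circle_proj_eq by blast
qed

lemma carrier_circle_group: "carrier circle_group = range circle_proj"
  by (auto simp: circle_group_def FactGroup_def RCOSETS_def circle_proj_def real_group_def)

lemma group_real_group: "group real_group"
proof (rule groupI)
  fix x assume "x \<in> carrier real_group"
  show "\<exists>y\<in>carrier real_group. y \<otimes>\<^bsub>real_group\<^esub> x = \<one>\<^bsub>real_group\<^esub>"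
    by (intro bexI[of _ "- x"]) (simp_all add: real_group_def)
qed (simp_all add: real_group_def)

lemma normal_Ints_real_group: "\<int> \<lhd> real_group"
proof -
  interpret comm_group real_group
    by (rule group.group_comm_groupI[OF group_real_group]) (simp add: real_group_def)
  have inv: "inv\<^bsub>real_group\<^esub> x = - x" for x
    by (rule inv_equality) (auto simp: real_group_def)
  have "subgroup \<int> real_group"
    by (rule subgroupI) (use inv in \<open>auto simp: real_group_def\<close>)
  then show ?thesis
    by (rule subgroup_imp_normal)
qed

lemma circle_proj_mult:
  "circle_proj s \<otimes>\<^bsub>circle_group\<^esub> circle_proj t = circle_proj (s + t)"
  using normal.rcos_sum[OF normal_Ints_real_group, of s t]
  by (simp add: circle_group_def circle_proj_def real_group_def)

lemma circle_proj_inv: "inv\<^bsub>circle_group\<^esub> circle_proj t = circle_proj (- t)"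
proof (rule group.inv_equality)
  show "group circle_group"
    unfolding circle_group_def by (rule normal.factorgroup_is_group[OF normal_Ints_real_group])
  have "\<one>\<^bsub>circle_group\<^esub> = circle_proj 0"
    by (auto simp: circle_group_def FactGroup_def circle_proj_eq Ints_def)
  then show "circle_proj (- t) \<otimes>\<^bsub>circle_group\<^esub> circle_proj t = \<one>\<^bsub>circle_group\<^esub>"
    by (simp add: circle_proj_mult)
qed (auto simp: carrier_circle_group)

lemma topspace_circle_topology: "topspace circle_topology = carrier circle_group"
proof -
  have "circle_proj -` range circle_proj = UNIV"
    by auto
  then have "openin circle_topology (carrier circle_group)"
    by (simp add: openin_circle_topology carrier_circle_group)
  then show ?thesis
    by (metis openin_circle_topology openin_subset openin_topspace subset_antisym)
qed

lemma quotient_map_circle_proj: "quotient_map euclidean circle_topology circle_proj"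
  by (auto simp: quotient_map_def topspace_circle_topology carrier_circle_group
      openin_circle_topology vimage_def)

lemma open_map_circle_proj: "open_map euclidean circle_topology circle_proj"
  unfolding open_map_def
proof (intro allI impI)
  fix U :: "real set" assume "openin euclidean U"
  then have U: "open U" by simp
  have "circle_proj -` (circle_proj ` U) = (\<Union>k::int. (+) (of_int k) ` U)"
  proof (intro subset_antisym subsetI)
    fix x assume "x \<in> circle_proj -` (circle_proj ` U)"
    then obtain u where u: "u \<in> U" "x - u \<in> \<int>" by (auto simp: circle_proj_eq_iff)
    then obtain k where "x - u = of_int k" by (auto elim: Ints_cases)
    then have "x = of_int k + u" by simp
    then show "x \<in> (\<Union>k::int. (+) (of_int k) ` U)" using u by blast
  next
    fix x assume "x \<in> (\<Union>k::int. (+) (of_int k) ` U)"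
    then obtain k u where "u \<in> U" "x = of_int (k::int) + u" by blast
    then have "circle_proj x = circle_proj u" by (simp add: circle_proj_eq_iff)
    then show "x \<in> circle_proj -` (circle_proj ` U)" using \<open>u \<in> U\<close> by auto
  qed
  then show "openin circle_topology (circle_proj ` U)"
    using U by (auto simp: openin_circle_topology carrier_circle_group intro: open_translation)
qed

lemma circle_compact_group: "compact_group circle_group circle_topology"
proof -
  let ?T = circle_topology
  interpret group circle_group
    unfolding circle_group_def by (rule normal.factorgroup_is_group[OF normal_Ints_real_group])
  have proj: "continuous_map euclidean ?T circle_proj"
    using quotient_map_circle_proj quotient_imp_continuous_map by blast
  have "circle_proj ` {0..1} = carrier circle_group"
  proof -
    have "circle_proj t = circle_proj (frac t)" for t
      by (simp add: circle_proj_eq_iff frac_def)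
    moreover have "frac t \<in> {0..1}" for t :: real
      by (simp add: frac_ge_0 less_imp_le[OF frac_lt_1])
    ultimately show ?thesis
      unfolding carrier_circle_group by blast
  qed
  then have comp: "compact_space ?T"
    unfolding compact_space_def topspace_circle_topology
    by (metis compact_Icc compactin_euclidean_iff image_compactin proj)
  have haus: "Hausdorff_space ?T"
  proof -
    have "circle_proj x = circle_proj y \<longleftrightarrow> cis (2 * pi * x) = cis (2 * pi * y)" for x y
    proof -
      have "cis (2 * pi * x) = cis (2 * pi * y) \<longleftrightarrow> cis (2 * pi * (x - y)) = 1"
        by (simp add: right_diff_distrib flip: cis_divide)
      also have "\<dots> \<longleftrightarrow> x - y \<in> \<int>"
        by (auto simp: cis_conv_exp exp_eq_1 Ints_def)
      finally show ?thesis by (simp add: circle_proj_eq_iff)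
    qed
    note eq = this
    have "continuous_map euclidean euclidean (\<lambda>x::real. cis (2 * pi * x))"
      by (auto intro!: continuous_intros)
    from quotient_map_lift_exists[OF quotient_map_circle_proj this]
    obtain g where g: "continuous_map ?T euclidean g"
      and "\<And>x. g (circle_proj x) = cis (2 * pi * x)"
      using eq by (metis UNIV_I topspace_euclidean)
    then have "inj_on g (topspace ?T)"
      by (auto simp: topspace_circle_topology carrier_circle_group inj_on_def eq)
    with g show ?thesis
      using Hausdorff_space_injective_preimage Hausdorff_space_euclidean by blast
  qed
  have mult: "continuous_map (prod_topology ?T ?T) ?T (\<lambda>(x, y). x \<otimes>\<^bsub>circle_group\<^esub> y)"
    unfolding continuous_map
  proof (intro conjI allI impI)
    show "(\<lambda>(x, y). x \<otimes>\<^bsub>circle_group\<^esub> y) ` topspace (prod_topology ?T ?T) \<subseteq> topspace ?T"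
      by (auto simp: topspace_circle_topology)
  next
    fix U assume U: "openin ?T U"
    let ?W = "{z \<in> topspace (prod_topology ?T ?T). (\<lambda>(x, y). x \<otimes>\<^bsub>circle_group\<^esub> y) z \<in> U}"
    show "openin (prod_topology ?T ?T) ?W"
      unfolding openin_prod_topology_alt
    proof (intro allI impI)
      fix a b assume "(a, b) \<in> ?W"
      then obtain s t where st: "a = circle_proj s" "b = circle_proj t" "circle_proj (s + t) \<in> U"
        by (auto simp: topspace_circle_topology carrier_circle_group circle_proj_mult)
      have "open ((\<lambda>z. fst z + snd z) -` (circle_proj -` U) :: (real \<times> real) set)"
        using U by (intro open_vimage) (auto simp: openin_circle_topology intro!: continuous_intros)
      moreover have "(s, t) \<in> (\<lambda>z. fst z + snd z) -` (circle_proj -` U)"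
        using st by simp
      ultimately obtain A B where AB: "open A" "open B" "s \<in> A" "t \<in> B"
        "A \<times> B \<subseteq> (\<lambda>z. fst z + snd z) -` (circle_proj -` U)"
        by (smt (verit, best) mem_Sigma_iff open_prod_def)
      have "circle_proj ` A \<times> circle_proj ` B \<subseteq> ?W"
        using AB(5) by (fastforce simp: topspace_circle_topology carrier_circle_group circle_proj_mult)
      moreover have "openin ?T (circle_proj ` A)" "openin ?T (circle_proj ` B)"
        using open_map_circle_proj AB by (auto simp: open_map_def)
      ultimately show "\<exists>V V'. openin ?T V \<and> openin ?T V' \<and> a \<in> V \<and> b \<in> V' \<and> V \<times> V' \<subseteq> ?W"
        using AB st by (intro exI[of _ "circle_proj ` A"] exI[of _ "circle_proj ` B"]) auto
    qed
  qed
  have "continuous_map euclidean ?T (circle_proj \<circ> uminus)"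
    by (rule continuous_map_compose[OF _ proj]) (auto intro!: continuous_intros)
  moreover have "circle_proj \<circ> uminus = (\<lambda>x. inv\<^bsub>circle_group\<^esub> x) \<circ> circle_proj"
    by (auto simp: circle_proj_inv)
  ultimately have inverse: "continuous_map ?T ?T (\<lambda>x. inv\<^bsub>circle_group\<^esub> x)"
    using continuous_compose_quotient_map[OF quotient_map_circle_proj] by metis
  show ?thesis
    by unfold_locales (use topspace_circle_topology comp haus mult inverse in auto)
qed

end

theory Submission
  imports Defs
begin

text \<open>Take \<open>t\<close> uniform in \<open>(-1, 1)\<close>, let \<open>Y\<close> be the class of \<open>t\<close> in \<open>\<real>/\<int>\<close>, and for \<open>t \<ge> 0\<close> cut the base
  \<open>p\<close> expansion of \<open>t\<close> into blocks, the block \<open>B\<^sub>j\<close> consisting of the digits in positions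
  \<open>j\<^sup>2 + 1, \<dots>, (j + 1)\<^sup>2\<close> read as an integer. Put \<open>X = \<Sum>\<^sub>j B\<^sub>j p\<^bsup>j\<^sup>2\<^esup>\<close> in \<open>\<int>\<^sub>p\<close>, and extend \<open>X\<close> to
  negative \<open>t\<close> as an odd function. Then \<open>(X, Y)\<close> is symmetric, and both \<open>X\<close> and \<open>Y\<close> are Haar
  distributed, so that their averaging operators vanish on the orthogonal complement of the
  constants. However \<open>X / p\<^bsup>(k + 1)\<^sup>2\<^esup>\<close> and \<open>p\<^bsup>k\<^sup>2\<^esup> Y\<close> are, modulo 1, both \<open>B\<^sub>k / p\<^bsup>2 k + 1\<^esup>\<close> up to an error of at most
  \<open>1 / p\<^bsup>2 k + 1\<^esup>\<close>. Hence the characters \<open>e(x / p\<^bsup>(k + 1)\<^sup>2\<^esup>) e(- p\<^bsup>k\<^sup>2\<^esup> y)\<close> are eigenfunctions of the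
  averaging operator of \<open>(X, Y)\<close> whose eigenvalues tend to 1.\<close>

section \<open>Borel sets and Haar measure\<close>

lemma space_borel_of [simp]: "space (borel_of T) = topspace T"
  unfolding borel_of_def by (rule space_measure_of) (auto dest: openin_subset)

lemma sets_borel_of: "sets (borel_of T) = sigma_sets (topspace T) {U. openin T U}"
  unfolding borel_of_def by (rule sets_measure_of) (auto dest: openin_subset)

lemma openin_borel_of: "openin T U \<Longrightarrow> U \<in> sets (borel_of T)"
  by (auto simp: sets_borel_of)

lemma closedin_borel_of:
  assumes "closedin T K" shows "K \<in> sets (borel_of T)"
proof -
  have "topspace T - (topspace T - K) \<in> sets (borel_of T)"
    using assms sets.compl_sets[of "topspace T - K" "borel_of T"]
    by (simp add: closedin_def openin_borel_of)
  with assms show ?thesis by (simp add: closedin_def double_diff)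
qed

lemma borel_of_euclidean: "borel_of euclidean = borel"
  by (simp add: borel_of_def borel_def)

lemma measurable_continuous_map:
  assumes "continuous_map S T f"
  shows "f \<in> borel_of S \<rightarrow>\<^sub>M borel_of T"
  unfolding borel_of_def[of T]
proof (rule measurable_measure_of)
  show "f \<in> space (borel_of S) \<rightarrow> topspace T"
    using assms by (auto simp: continuous_map_def)
  fix U assume "U \<in> {U. openin T U}"
  then have "openin S {x \<in> topspace S. f x \<in> U}"
    using openin_continuous_map_preimage[OF assms] by simp
  moreover have "f -` U \<inter> space (borel_of S) = {x \<in> topspace S. f x \<in> U}"
    by auto
  ultimately show "f -` U \<inter> space (borel_of S) \<in> sets (borel_of S)"
    by (simp add: openin_borel_of)
qed (auto dest: openin_subset)

text \<open>Products of members of two countable bases suffice. The rectangles are kept explicit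
  because each is measurable for the product sigma-algebra, which \<open>sets_borel_of_prod\<close>
  needs.\<close>

lemma countable_rectangle_base:
  assumes "second_countable S" "second_countable T"
  obtains R where "countable R" "\<forall>D\<in>R. \<exists>V W. D = V \<times> W \<and> openin S V \<and> openin T W"
    "\<forall>U z. openin (prod_topology S T) U \<and> z \<in> U \<longrightarrow> (\<exists>D\<in>R. z \<in> D \<and> D \<subseteq> U)"
proof -
  obtain B where B: "countable B" "\<And>V. V \<in> B \<Longrightarrow> openin S V"
    "\<And>U x. openin S U \<Longrightarrow> x \<in> U \<Longrightarrow> \<exists>V\<in>B. x \<in> V \<and> V \<subseteq> U"
    using assms(1) unfolding second_countable_def by metis
  obtain C where C: "countable C" "\<And>V. V \<in> C \<Longrightarrow> openin T V"
    "\<And>U x. openin T U \<Longrightarrow> x \<in> U \<Longrightarrow> \<exists>V\<in>C. x \<in> V \<and> V \<subseteq> U"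
    using assms(2) unfolding second_countable_def by metis
  let ?R = "(\<lambda>(V, W). V \<times> W) ` (B \<times> C)"
  show thesis
  proof
    show "countable ?R" using B(1) C(1) by (intro countable_image countable_SIGMA)
    show "\<forall>D\<in>?R. \<exists>V W. D = V \<times> W \<and> openin S V \<and> openin T W"
    proof clarify
      fix V W assume "V \<in> B" "W \<in> C"
      then show "\<exists>V' W'. V \<times> W = V' \<times> W' \<and> openin S V' \<and> openin T W'"
        using B(2) C(2) by (intro exI conjI) auto
    qed
    have base: "\<exists>D\<in>?R. z \<in> D \<and> D \<subseteq> U" if U: "openin (prod_topology S T) U" and z: "z \<in> U" for U z
    proof -
      obtain V W where VW: "openin S V" "openin T W" "fst z \<in> V" "snd z \<in> W" "V \<times> W \<subseteq> U"
        using iffD1[OF openin_prod_topology_alt U, rule_format, of "fst z" "snd z"] z by fastforce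
      obtain V' where "V' \<in> B" "fst z \<in> V'" "V' \<subseteq> V"
        using B(3)[OF VW(1,3)] by blast
      moreover obtain W' where "W' \<in> C" "snd z \<in> W'" "W' \<subseteq> W"
        using C(3)[OF VW(2,4)] by blast
      ultimately show ?thesis
        using VW(5) by (intro bexI[of _ "V' \<times> W'"]) (auto simp: mem_Times_iff)
    qed
    show "\<forall>U z. openin (prod_topology S T) U \<and> z \<in> U \<longrightarrow> (\<exists>D\<in>?R. z \<in> D \<and> D \<subseteq> U)"
      by (intro allI impI base; elim conjE)
  qed
qed

lemma second_countable_prod:
  assumes "second_countable S" "second_countable T"
  shows "second_countable (prod_topology S T)"
proof -
  obtain R where R: "countable R" "\<forall>D\<in>R. \<exists>V W. D = V \<times> W \<and> openin S V \<and> openin T W"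
    "\<forall>U z. openin (prod_topology S T) U \<and> z \<in> U \<longrightarrow> (\<exists>D\<in>R. z \<in> D \<and> D \<subseteq> U)"
    using countable_rectangle_base[OF assms] .
  show ?thesis
    unfolding second_countable_def
    by (intro exI[of _ R] conjI R) (use R(2) in \<open>auto simp: openin_prod_Times_iff\<close>)
qed

text \<open>One inclusion is the measurability of the two projections. For the other, second
  countability writes every open set as a countable union of open rectangles.\<close>

lemma sets_borel_of_prod:
  assumes "second_countable S" "second_countable T"
  shows "sets (borel_of (prod_topology S T)) = sets (borel_of S \<Otimes>\<^sub>M borel_of T)"
proof
  have id: "(\<lambda>z. z) \<in> borel_of (prod_topology S T) \<rightarrow>\<^sub>M (borel_of S \<Otimes>\<^sub>M borel_of T)"
    using measurable_Pair[OF measurable_continuous_map[OF continuous_map_fst[of S T]]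
        measurable_continuous_map[OF continuous_map_snd[of S T]]]
    by simp
  show "sets (borel_of S \<Otimes>\<^sub>M borel_of T) \<subseteq> sets (borel_of (prod_topology S T))"
  proof
    fix A assume A: "A \<in> sets (borel_of S \<Otimes>\<^sub>M borel_of T)"
    then have "A \<subseteq> topspace S \<times> topspace T"
      using sets.sets_into_space by (fastforce simp: space_pair_measure)
    with measurable_sets[OF id A] show "A \<in> sets (borel_of (prod_topology S T))"
      by (simp add: Int_absorb2)
  qed
  obtain R where R: "countable R" "\<forall>D\<in>R. \<exists>V W. D = V \<times> W \<and> openin S V \<and> openin T W"
    "\<forall>U z. openin (prod_topology S T) U \<and> z \<in> U \<longrightarrow> (\<exists>D\<in>R. z \<in> D \<and> D \<subseteq> U)"
    using countable_rectangle_base[OF assms] .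
  have "U \<in> sets (borel_of S \<Otimes>\<^sub>M borel_of T)" if U: "openin (prod_topology S T) U" for U
  proof -
    have "U = \<Union> {D \<in> R. D \<subseteq> U}"
      using R(3) U by blast
    also have "\<dots> \<in> sets (borel_of S \<Otimes>\<^sub>M borel_of T)"
    proof (rule sets.countable_Union)
      show "countable {D \<in> R. D \<subseteq> U}" using R(1) by (rule countable_subset[rotated]) auto
    qed (use R(2) in \<open>auto intro!: openin_borel_of\<close>)
    finally show ?thesis .
  qed
  then show "sets (borel_of (prod_topology S T)) \<subseteq> sets (borel_of S \<Otimes>\<^sub>M borel_of T)"
    unfolding sets_borel_of[of "prod_topology S T"]
    by (intro sets.sigma_sets_subset') (auto simp: space_pair_measure intro!: openin_borel_of)
qed

text \<open>Finite Borel measures on Polish spaces are inner regular. Compact subsets of the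
  preimage of \<open>A\<close> are pushed forward by \<open>\<phi>\<close>; their images are
  compact, hence closed and Borel in a Hausdorff space.\<close>

lemma distr_inner_regular:
  fixes \<mu> :: "'b::{second_countable_topology, complete_space} measure"
  assumes fin: "emeasure \<mu> (space \<mu>) \<noteq> \<infinity>" and sets: "sets \<mu> = sets borel"
    and cont: "continuous_map euclidean T \<phi>" and "Hausdorff_space T"
    and A: "A \<in> sets (borel_of T)"
  shows "emeasure (distr \<mu> (borel_of T) \<phi>) A =
    (SUP K\<in>{K. compactin T K \<and> K \<subseteq> A}. emeasure (distr \<mu> (borel_of T) \<phi>) K)"
proof (rule antisym)
  let ?m = "distr \<mu> (borel_of T) \<phi>"
  have meas: "\<phi> \<in> \<mu> \<rightarrow>\<^sub>M borel_of T"
    using measurable_continuous_map[OF cont]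
    by (simp add: borel_of_euclidean measurable_cong_sets[OF sets refl])
  have sp: "space \<mu> = UNIV"
    using sets_eq_imp_space_eq[OF sets] by simp
  have pre: "\<phi> -` A \<in> sets borel"
    using measurable_sets[OF meas A] by (simp add: sp sets)
  have "emeasure ?m A = emeasure \<mu> (\<phi> -` A)"
    using emeasure_distr[OF meas A] by (simp add: sp)
  also have "\<dots> = (SUP K\<in>{K. K \<subseteq> \<phi> -` A \<and> compact K}. emeasure \<mu> K)"
    by (rule inner_regular[OF sets fin pre])
  also have "\<dots> \<le> (SUP K\<in>{K. compactin T K \<and> K \<subseteq> A}. emeasure ?m K)"
  proof (rule SUP_mono)
    fix K assume K: "K \<in> {K. K \<subseteq> \<phi> -` A \<and> compact K}"
    then have c: "compactin T (\<phi> ` K)"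
      using image_compactin[OF _ cont] by auto
    then have b: "\<phi> ` K \<in> sets (borel_of T)"
      using \<open>Hausdorff_space T\<close> compactin_imp_closedin closedin_borel_of by blast
    have "emeasure \<mu> K \<le> emeasure \<mu> (\<phi> -` (\<phi> ` K))"
      using measurable_sets[OF meas b] by (intro emeasure_mono) (auto simp: sp)
    also have "\<dots> = emeasure ?m (\<phi> ` K)"
      using emeasure_distr[OF meas b] by (simp add: sp)
    finally show "\<exists>L\<in>{K. compactin T K \<and> K \<subseteq> A}. emeasure \<mu> K \<le> emeasure ?m L"
      using K c by (intro bexI[of _ "\<phi> ` K"]) auto
  qed
  finally show "emeasure ?m A \<le> (SUP K\<in>{K. compactin T K \<and> K \<subseteq> A}. emeasure ?m K)" .
  show "(SUP K\<in>{K. compactin T K \<and> K \<subseteq> A}. emeasure ?m K) \<le> emeasure ?m A"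
    using A by (intro SUP_least emeasure_mono) auto
qed

section \<open>Haar probability measures as image measures\<close>

lemma is_haar_prob_imp:
  assumes "is_haar_prob G T m"
  shows "prob_space m" "sets m = sets (borel_of T)" "space m = topspace T"
    "g \<in> carrier G \<Longrightarrow> distr m (borel_of T) (\<lambda>x. g \<otimes>\<^bsub>G\<^esub> x) = m"
  using assms sets_eq_imp_space_eq[of m "borel_of T"] by (auto simp: is_haar_prob_def)

text \<open>This is how every Haar measure below is recognized: for a continuous image of a Polish
  probability space, only translation invariance has to be checked.\<close>

lemma is_haar_prob_distr:
  fixes \<mu> :: "'b::{second_countable_topology, complete_space} measure"
  assumes "prob_space \<mu>" "sets \<mu> = sets borel" "continuous_map euclidean T \<phi>" "Hausdorff_space T"
    and "\<And>g. g \<in> carrier G \<Longrightarrow> distr (distr \<mu> (borel_of T) \<phi>) (borel_of T) (\<lambda>x. g \<otimes>\<^bsub>G\<^esub> x)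
           = distr \<mu> (borel_of T) \<phi>"
  shows "is_haar_prob G T (distr \<mu> (borel_of T) \<phi>)"
proof -
  interpret prob_space \<mu> by fact
  have "\<phi> \<in> \<mu> \<rightarrow>\<^sub>M borel_of T"
    using measurable_continuous_map[OF assms(3)]
    by (simp add: borel_of_euclidean measurable_cong_sets[OF assms(2) refl])
  then show ?thesis
    using distr_inner_regular[OF _ assms(2-4)] assms(5)
    by (simp add: is_haar_prob_def prob_space_distr emeasure_space_1)
qed

section \<open>Averaging operators on abelian groups\<close>

text \<open>Second countability makes multiplication measurable for the product sigma-algebra, as
  Fubini requires; commutativity turns left translations into right ones.\<close>

locale abelian_compact_group = compact_group G T + comm_group G
  for G :: "'a monoid" (structure) and T +
  assumes second_countable: "second_countable T"
begin

lemma measurable_translation: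
  assumes "g \<in> carrier G" shows "(\<lambda>x. g \<otimes> x) \<in> borel_of T \<rightarrow>\<^sub>M borel_of T"
proof -
  have "continuous_map T (prod_topology T T) (\<lambda>x. (g, x))"
    using assms topspace_eq by (simp add: continuous_map_pairwise o_def)
  from continuous_map_compose[OF this continuous_mult] show ?thesis
    by (auto intro: measurable_continuous_map simp: o_def)
qed

lemma measurable_inv: "(\<lambda>x. inv x) \<in> borel_of T \<rightarrow>\<^sub>M borel_of T"
  by (rule measurable_continuous_map[OF continuous_inv])

text \<open>Integrate the indicator function of \<open>A\<close> at \<open>x \<otimes> y\<close> over the product measure in both orders.\<close>

lemma is_haar_prob_unique:
  assumes m: "is_haar_prob G T m" and n: "is_haar_prob G T n"
  shows "m = n"
proof (rule measure_eqI)
  interpret m: prob_space m by (rule is_haar_prob_imp[OF m])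
  interpret n: prob_space n by (rule is_haar_prob_imp[OF n])
  interpret mn: pair_prob_space m n ..
  show sets: "sets m = sets n"
    using is_haar_prob_imp(2)[OF m] is_haar_prob_imp(2)[OF n] by simp
  fix A assume "A \<in> sets m"
  then have A: "A \<in> sets (borel_of T)" using is_haar_prob_imp(2)[OF m] by simp
  have sp: "space m = carrier G" "space n = carrier G"
    using is_haar_prob_imp(3)[OF m] is_haar_prob_imp(3)[OF n] topspace_eq by simp_all
  have pairs: "sets (m \<Otimes>\<^sub>M n) = sets (borel_of (prod_topology T T))"
    using sets_borel_of_prod[OF second_countable second_countable] is_haar_prob_imp(2)[OF m] is_haar_prob_imp(2)[OF n]
    by (metis sets_pair_measure_cong)
  have "(\<lambda>(x, y). indicator A (x \<otimes> y) :: ennreal) \<in> borel_measurable (m \<Otimes>\<^sub>M n)"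
    using measurable_compose[OF measurable_continuous_map[OF continuous_mult]
        borel_measurable_indicator[OF A]]
    by (simp add: measurable_cong_sets[OF pairs refl] case_prod_unfold)
  then have "(\<integral>\<^sup>+y. \<integral>\<^sup>+x. indicator A (x \<otimes> y) \<partial>m \<partial>n) = (\<integral>\<^sup>+x. \<integral>\<^sup>+y. indicator A (x \<otimes> y) \<partial>n \<partial>m)"
    by (rule mn.Fubini')
  moreover have translate: "(\<integral>\<^sup>+x. indicator A (g \<otimes> x) \<partial>k) = emeasure k A"
    if k: "is_haar_prob G T k" and g: "g \<in> carrier G" for k g
  proof -
    have "emeasure k A = (\<integral>\<^sup>+x. indicator A x \<partial>distr k (borel_of T) (\<lambda>x. g \<otimes> x))"
      using A is_haar_prob_imp(2)[OF k] by (simp add: is_haar_prob_imp(4)[OF k g])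
    also have "\<dots> = (\<integral>\<^sup>+x. indicator A (g \<otimes> x) \<partial>k)"
      using A measurable_translation[OF g] is_haar_prob_imp(2)[OF k]
      by (intro nn_integral_distr) (auto simp: measurable_cong_sets[OF is_haar_prob_imp(2)[OF k] refl])
    finally show ?thesis by simp
  qed
  have "(\<integral>\<^sup>+x. \<integral>\<^sup>+y. indicator A (x \<otimes> y) \<partial>n \<partial>m) = (\<integral>\<^sup>+x. emeasure n A \<partial>m)"
    by (intro nn_integral_cong translate[OF n]) (simp add: sp)
  moreover have "(\<integral>\<^sup>+y. \<integral>\<^sup>+x. indicator A (x \<otimes> y) \<partial>m \<partial>n) = (\<integral>\<^sup>+y. emeasure m A \<partial>n)"
  proof (rule nn_integral_cong)
    fix y assume y: "y \<in> space n"
    \<comment> \<open>The integration variable is now the left factor, while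
      \<open>is_haar_prob\<close> only gives invariance under left translation; commutativity
      bridges the two.\<close>
    have "(\<integral>\<^sup>+x. indicator A (x \<otimes> y) \<partial>m) = (\<integral>\<^sup>+x. indicator A (y \<otimes> x) \<partial>m)"
      using y by (intro nn_integral_cong) (simp add: sp m_comm)
    then show "(\<integral>\<^sup>+x. indicator A (x \<otimes> y) \<partial>m) = emeasure m A"
      using translate[OF m] y by (simp add: sp)
  qed
  ultimately show "emeasure m A = emeasure n A"
    by (simp add: m.emeasure_space_1 n.emeasure_space_1)
qed

text \<open>By uniqueness, the measure selected by the choice operator is any Haar measure that has
  been constructed explicitly.\<close>

lemma haar_prob_eqI:
  assumes "is_haar_prob G T m"
  shows "haar_prob G T = m"
  using is_haar_prob_unique[OF _ assms] someI[of "is_haar_prob G T", OF assms]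
  by (simp add: haar_prob_def)

text \<open>Replacing \<open>g\<close> by its inverse and then translating by \<open>x\<close> turns
  the average at \<open>x\<close> into the integral of \<open>f\<close>. This is zero when
  \<open>f\<close> is orthogonal to the constants, so every image has norm 0.\<close>

lemma spectral_gap_haar:
  assumes m: "is_haar_prob G T m"
    and symm: "symmetric_borel_prob G T m"
  shows "spectral_gap G T m"
proof -
  have sp: "space m = carrier G"
    using is_haar_prob_imp(3)[OF m] topspace_eq by simp
  have "averaging_op G m f x = 0" if f: "f \<in> constants_perp m" and x: "x \<in> carrier G" for f x
  proof -
    note cong = measurable_cong_sets[OF is_haar_prob_imp(2)[OF m] refl]
    have f_meas: "f \<in> borel_measurable (borel_of T)"
      using f by (auto simp: constants_perp_def L2_def cong)
    have "(LINT g|m. f (inv g \<otimes> x)) = (LINT g|m. f (x \<otimes> inv g))"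
      using x by (intro Bochner_Integration.integral_cong) (auto simp: sp m_comm)
    also have "\<dots> = (LINT g|distr m (borel_of T) (\<lambda>g. inv g). f (x \<otimes> g))"
      by (rule integral_distr[symmetric])
        (use measurable_inv measurable_compose[OF measurable_translation[OF x] f_meas] in \<open>auto simp: cong\<close>)
    also have "\<dots> = (LINT g|m. f (x \<otimes> g))"
      using symm by (simp add: symmetric_borel_prob_def)
    also have "\<dots> = (LINT g|distr m (borel_of T) (\<lambda>g. x \<otimes> g). f g)"
      by (rule integral_distr[symmetric])
        (use measurable_translation[OF x] f_meas in \<open>auto simp: cong\<close>)
    also have "\<dots> = (LINT g|m. f g)"
      by (simp add: is_haar_prob_imp(4)[OF m x])
    also have "\<dots> = 0"
      \<comment> \<open>The inner product with the constant 1 is the integral of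
        \<open>f\<close>.\<close>
      using f by (auto simp: constants_perp_def L2_inner_def dest!: spec[of _ 1])
    finally show ?thesis by (simp add: averaging_op_def)
  qed
  then have "L2_norm m (averaging_op G m f) = 0" if "f \<in> constants_perp m" for f
    using that sp Bochner_Integration.integral_cong[of m m "\<lambda>x. (cmod (averaging_op G m f x))\<^sup>2" "\<lambda>_. 0"]
    by (simp add: L2_norm_def)
  then have "op_norm_on m (constants_perp m) (averaging_op G m) \<le> 0"
    unfolding op_norm_on_def by (intro SUP_least) auto
  then have "op_norm_on m (constants_perp m) (averaging_op G m) < 1"
    by (rule order.strict_trans1) simp
  then show ?thesis
    by (simp add: spectral_gap_def symm haar_prob_eqI[OF m])
qed

text \<open>A nontrivial character is a unit vector orthogonal to the constants and an eigenfunction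
  of the averaging operator; its eigenvalue is the conjugate of its integral against
  \<open>\<nu>\<close>.\<close>

lemma op_norm_ge_character:
  assumes m: "is_haar_prob G T m" and \<nu>: "prob_space \<nu>" "sets \<nu> = sets (borel_of T)"
    and f: "f \<in> borel_measurable (borel_of T)"
    and norm: "\<And>x. x \<in> carrier G \<Longrightarrow> cmod (f x) = 1"
    and hom: "\<And>x y. x \<in> carrier G \<Longrightarrow> y \<in> carrier G \<Longrightarrow> f (x \<otimes> y) = f x * f y"
    and z: "z \<in> carrier G" "f z \<noteq> 1"
  shows "ereal (cmod (LINT x|\<nu>. f x)) \<le> op_norm_on m (constants_perp m) (averaging_op G \<nu>)"
proof -
  interpret m: prob_space m by (rule is_haar_prob_imp[OF m])
  have sp: "space m = carrier G" "space \<nu> = carrier G"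
    using is_haar_prob_imp(3)[OF m] topspace_eq sets_eq_imp_space_eq[OF \<nu>(2)] by simp_all
  note cong = measurable_cong_sets[OF is_haar_prob_imp(2)[OF m] refl]
  have fm: "f \<in> borel_measurable m" using f by (simp add: cong)
  have "integrable m (\<lambda>x. (cmod (f x))\<^sup>2)"
    by (rule m.integrable_const_bound[where B = 1]) (use fm norm in \<open>auto simp: sp\<close>)
  with fm have L2: "f \<in> L2 m" by (simp add: L2_def)
  have norm_mult: "L2_norm m (\<lambda>x. c * f x) = cmod c" for c
  proof -
    have "(LINT x|m. (cmod (c * f x))\<^sup>2) = (LINT x|m. (cmod c)\<^sup>2)"
      by (rule Bochner_Integration.integral_cong) (auto simp: sp norm norm_mult)
    then show ?thesis by (simp add: L2_norm_def m.prob_space)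
  qed
  \<comment> \<open>Translation by \<open>z\<close> multiplies the integral by \<open>f z\<close>,
    which differs from 1, so the integral vanishes.\<close>
  have "(LINT x|m. f x) = (LINT x|distr m (borel_of T) (\<lambda>x. z \<otimes> x). f x)"
    by (simp add: is_haar_prob_imp(4)[OF m z(1)])
  also have "\<dots> = (LINT x|m. f (z \<otimes> x))"
    by (rule integral_distr) (use measurable_translation[OF z(1)] f in \<open>auto simp: cong\<close>)
  also have "\<dots> = (LINT x|m. f z * f x)"
    using z by (intro Bochner_Integration.integral_cong) (auto simp: sp hom)
  finally have "(LINT x|m. f x) = 0"
    using z(2) by simp
  then have perp: "f \<in> constants_perp m"
    using L2 by (simp add: constants_perp_def L2_inner_def)
  have inv: "f (inv g) = cnj (f g)" if "g \<in> carrier G" for g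
  proof -
    have "f \<one> = 1"
      using hom[of \<one> \<one>] norm[of \<one>] by auto
    then have "f (inv g) * f g = 1"
      using hom[of "inv g" g] that by simp
    moreover have "f g * cnj (f g) = 1"
      using norm[OF that] by (simp flip: complex_norm_square)
    ultimately show ?thesis
      by (metis mult.assoc mult.commute mult_1)
  qed
  have "averaging_op G \<nu> f x = cnj (LINT g|\<nu>. f g) * f x" if "x \<in> carrier G" for x
  proof -
    have "averaging_op G \<nu> f x = (LINT g|\<nu>. cnj (f g) * f x)"
      unfolding averaging_op_def using that
      by (intro Bochner_Integration.integral_cong) (auto simp: sp hom inv)
    then show ?thesis by simp
  qed
  then have "L2_norm m (averaging_op G \<nu> f) = L2_norm m (\<lambda>x. cnj (LINT g|\<nu>. f g) * f x)"
    unfolding L2_norm_def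
    by (intro arg_cong[of _ _ sqrt] Bochner_Integration.integral_cong) (auto simp: sp)
  then have "cmod (LINT g|\<nu>. f g) = L2_norm m (averaging_op G \<nu> f)"
    using norm_mult[of "cnj (LINT g|\<nu>. f g)"] by simp
  moreover have "L2_norm m f \<le> 1"
    using norm_mult[of 1] by simp
  ultimately show ?thesis
    unfolding op_norm_on_def using perp by (auto intro: SUP_upper2)
qed

end

lemma second_countable_euclidean: "second_countable (euclidean :: 'a::second_countable_topology topology)"
proof -
  obtain B :: "'a set set" where "countable B" "topological_basis B"
    using ex_countable_basis by blast
  then show ?thesis
    unfolding second_countable_def open_openin[symmetric]
    by (metis topological_basisE topological_basis_open)
qed

section \<open>Products\<close>

lemma compact_group_DirProd:
  assumes "compact_group G S" "compact_group H T"
  shows "compact_group (G \<times>\<times> H) (prod_topology S T)"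
proof -
  interpret G: compact_group G S by fact
  interpret H: compact_group H T by fact
  interpret GH: group "G \<times>\<times> H"
    by (rule DirProd_group) unfold_locales
  let ?P = "prod_topology S T"
  have mult: "continuous_map (prod_topology ?P ?P) ?P (\<lambda>(x, y). x \<otimes>\<^bsub>G \<times>\<times> H\<^esub> y)"
  proof -
    \<comment> \<open>The four coordinates of a pair of pairs, ordered so that \<open>c(1,2)\<close>
      feed the multiplication of \<open>G\<close> and \<open>c(3,4)\<close> that of
      \<open>H\<close>.\<close>
    note c = continuous_map_compose[OF continuous_map_fst[of ?P ?P] continuous_map_fst[of S T], unfolded o_def]
      continuous_map_compose[OF continuous_map_snd[of ?P ?P] continuous_map_fst[of S T], unfolded o_def]
      continuous_map_compose[OF continuous_map_fst[of ?P ?P] continuous_map_snd[of S T], unfolded o_def]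
      continuous_map_compose[OF continuous_map_snd[of ?P ?P] continuous_map_snd[of S T], unfolded o_def]
    show ?thesis
      unfolding case_prod_unfold mult_DirProd'
      using continuous_map_compose[OF continuous_map_pairedI[OF c(1,2)] G.continuous_mult]
        continuous_map_compose[OF continuous_map_pairedI[OF c(3,4)] H.continuous_mult]
      unfolding o_def case_prod_unfold fst_conv snd_conv by (rule continuous_map_pairedI)
  qed
  have "continuous_map ?P ?P (\<lambda>z. (inv\<^bsub>G\<^esub> fst z, inv\<^bsub>H\<^esub> snd z))"
    using continuous_map_compose[OF continuous_map_fst[of S T] G.continuous_inv]
      continuous_map_compose[OF continuous_map_snd[of S T] H.continuous_inv]
    by (simp add: continuous_map_pairwise o_def)
  then have inv: "continuous_map ?P ?P (\<lambda>z. inv\<^bsub>G \<times>\<times> H\<^esub> z)"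
    by (rule continuous_map_eq)
      (auto simp: G.topspace_eq H.topspace_eq inv_DirProd G.is_group H.is_group)
  show ?thesis
  proof
    show "topspace ?P = carrier (G \<times>\<times> H)"
      by (simp add: G.topspace_eq H.topspace_eq)
    show "compact_space ?P"
      by (simp add: compact_space_prod_topology G.compact H.compact)
    show "Hausdorff_space ?P"
      by (simp add: Hausdorff_space_prod_topology G.Hausdorff H.Hausdorff)
  qed (fact mult inv)+
qed

lemma abelian_compact_group_DirProd:
  assumes "abelian_compact_group G S" "abelian_compact_group H T"
  shows "abelian_compact_group (G \<times>\<times> H) (prod_topology S T)"
proof -
  interpret G: abelian_compact_group G S by fact
  interpret H: abelian_compact_group H T by fact
  interpret GH: compact_group "G \<times>\<times> H" "prod_topology S T"
    by (rule compact_group_DirProd) unfold_locales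
  have "comm_group (G \<times>\<times> H)"
    by (rule GH.group_comm_groupI) (auto simp: G.m_comm H.m_comm)
  then show ?thesis
    by (intro abelian_compact_group.intro abelian_compact_group_axioms.intro GH.compact_group_axioms
        second_countable_prod G.second_countable H.second_countable)
qed

text \<open>The image of the product measure is the product of the two images, and a translation
  acts on each factor separately. The Haar measures are given as continuous images of Polish spaces
  so that the same holds for their product and yields inner regularity.\<close>

lemma is_haar_prob_DirProd:
  fixes \<mu> :: "'c::{second_countable_topology, complete_space} measure"
    and \<nu> :: "'d::{second_countable_topology, complete_space} measure"
  assumes G: "abelian_compact_group G S" and H: "abelian_compact_group H T"
    and \<mu>: "prob_space \<mu>" "sets \<mu> = sets borel" "continuous_map euclidean S \<phi>"
    and \<nu>: "prob_space \<nu>" "sets \<nu> = sets borel" "continuous_map euclidean T \<psi>"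
    and haar: "is_haar_prob G S (distr \<mu> (borel_of S) \<phi>)" "is_haar_prob H T (distr \<nu> (borel_of T) \<psi>)"
  shows "is_haar_prob (G \<times>\<times> H) (prod_topology S T)
    (distr (\<mu> \<Otimes>\<^sub>M \<nu>) (borel_of (prod_topology S T)) (\<lambda>(x, y). (\<phi> x, \<psi> y)))"
proof (rule is_haar_prob_distr)
  interpret G: abelian_compact_group G S by fact
  interpret H: abelian_compact_group H T by fact
  interpret \<mu>: prob_space \<mu> by fact
  interpret \<nu>: prob_space \<nu> by fact
  show "prob_space (\<mu> \<Otimes>\<^sub>M \<nu>)" by (rule prob_space_pair) fact+
  show "sets (\<mu> \<Otimes>\<^sub>M \<nu>) = sets borel"
    using sets_pair_measure_cong[OF \<mu>(2) \<nu>(2)] by (metis borel_prod)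
  have "continuous_map (prod_topology euclidean euclidean) (prod_topology S T) (\<lambda>z. (\<phi> (fst z), \<psi> (snd z)))"
    using continuous_map_compose[OF continuous_map_fst[of euclidean euclidean] \<mu>(3)]
      continuous_map_compose[OF continuous_map_snd[of euclidean euclidean] \<nu>(3)]
    unfolding continuous_map_pairwise o_def by simp
  then show "continuous_map euclidean (prod_topology S T) (\<lambda>(x, y). (\<phi> x, \<psi> y))"
    by (simp add: case_prod_unfold)
  show "Hausdorff_space (prod_topology S T)"
    by (simp add: Hausdorff_space_prod_topology G.Hausdorff H.Hausdorff)
  let ?m = "distr \<mu> (borel_of S) \<phi>" and ?n = "distr \<nu> (borel_of T) \<psi>"
  have meas: "\<phi> \<in> \<mu> \<rightarrow>\<^sub>M borel_of S" "\<psi> \<in> \<nu> \<rightarrow>\<^sub>M borel_of T"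
    using measurable_continuous_map[OF \<mu>(3)] measurable_continuous_map[OF \<nu>(3)]
    by (simp_all add: borel_of_euclidean measurable_cong_sets[OF \<mu>(2) refl]
        measurable_cong_sets[OF \<nu>(2) refl])
  interpret n: prob_space ?n by (rule is_haar_prob_imp[OF haar(2)])
  note sets = sets_borel_of_prod[OF G.second_countable H.second_countable]
  have eq: "distr (\<mu> \<Otimes>\<^sub>M \<nu>) (borel_of (prod_topology S T)) (\<lambda>(x, y). (\<phi> x, \<psi> y)) = ?m \<Otimes>\<^sub>M ?n"
    using pair_measure_distr[OF meas n.sigma_finite_measure_axioms]
    by (simp add: distr_cong[OF refl sets refl])
  fix z assume "z \<in> carrier (G \<times>\<times> H)"
  then obtain g h where z: "z = (g, h)" "g \<in> carrier G" "h \<in> carrier H" by auto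
  have "distr (?m \<Otimes>\<^sub>M ?n) (borel_of (prod_topology S T)) (\<lambda>x. z \<otimes>\<^bsub>G \<times>\<times> H\<^esub> x)
    = distr (?m \<Otimes>\<^sub>M ?n) (borel_of S \<Otimes>\<^sub>M borel_of T) (\<lambda>(x, y). (g \<otimes>\<^bsub>G\<^esub> x, h \<otimes>\<^bsub>H\<^esub> y))"
    by (rule distr_cong) (auto simp: sets z)
  also have "\<dots> = distr ?m (borel_of S) (\<lambda>x. g \<otimes>\<^bsub>G\<^esub> x) \<Otimes>\<^sub>M distr ?n (borel_of T) (\<lambda>y. h \<otimes>\<^bsub>H\<^esub> y)"
    by (rule pair_measure_distr[symmetric])
      (use G.measurable_translation[OF z(2)] H.measurable_translation[OF z(3)]
        is_haar_prob_imp(4)[OF haar(2) z(3)] n.sigma_finite_measure_axioms in \<open>simp_all\<close>)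
  finally show "distr (distr (\<mu> \<Otimes>\<^sub>M \<nu>) (borel_of (prod_topology S T)) (\<lambda>(x, y). (\<phi> x, \<psi> y)))
      (borel_of (prod_topology S T)) (\<lambda>x. z \<otimes>\<^bsub>G \<times>\<times> H\<^esub> x)
    = distr (\<mu> \<Otimes>\<^sub>M \<nu>) (borel_of (prod_topology S T)) (\<lambda>(x, y). (\<phi> x, \<psi> y))"
    by (simp add: eq is_haar_prob_imp(4)[OF haar(1) z(2)] is_haar_prob_imp(4)[OF haar(2) z(3)])
qed

section \<open>Haar measure on the circle\<close>

text \<open>The interval is symmetric, so odd functions get symmetric laws; having length 2, it
  wraps exactly twice around the circle and still projects to Haar measure.\<close>

definition unif :: "real measure" where
  "unif = uniform_measure lborel {-1<..<1}"

lemma sets_unif [simp, measurable_cong]: "sets unif = sets borel"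
  by (simp add: unif_def)

lemma space_unif [simp]: "space unif = UNIV"
  by (simp add: unif_def)

lemma prob_space_unif: "prob_space unif"
  unfolding unif_def by (rule prob_space_uniform_measure) auto

lemma emeasure_unif: "A \<in> sets borel \<Longrightarrow> emeasure unif A = emeasure lborel ({-1<..<1} \<inter> A) / 2"
  by (simp add: unif_def)

lemma emeasure_lborel_uminus:
  "A \<in> sets borel \<Longrightarrow> emeasure lborel (uminus -` A) = emeasure lborel (A :: real set)"
  using emeasure_distr[of uminus lborel borel A] by (simp add: lborel_distr_uminus)

lemma emeasure_lborel_translation:
  "A \<in> sets borel \<Longrightarrow> emeasure lborel ((\<lambda>x. c + x) -` A) = emeasure lborel (A :: real set)"
  using emeasure_distr[of "(+) c" lborel borel A] by (simp add: lborel_distr_plus)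

lemma distr_unif_uminus: "distr unif borel uminus = unif"
proof (rule measure_eqI)
  fix A assume "A \<in> sets (distr unif borel uminus)"
  then have A [measurable]: "A \<in> sets borel" by simp
  have "{-1<..<1} \<inter> uminus -` A = uminus -` ({-1<..<1} \<inter> A)" by auto
  then show "emeasure (distr unif borel uminus) A = emeasure unif A"
    using measurable_sets[of uminus borel borel A] emeasure_lborel_uminus[of "{-1<..<1} \<inter> A"]
    by (simp add: emeasure_distr emeasure_unif)
qed simp

text \<open>The left endpoint is a null set; with it the interval becomes a fundamental domain for
  translation by 2.\<close>

lemma emeasure_unif_Ico:
  assumes A: "A \<in> sets borel"
  shows "emeasure unif A = emeasure lborel ({-1..<1} \<inter> A) / 2"
proof -
  have "emeasure lborel ({-1..<1} \<inter> A) = emeasure lborel (({-1..<1} \<inter> A) - {-1})"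
    using A by (intro emeasure_Diff_null_set[symmetric]) auto
  also have "({-1..<1} \<inter> A) - {-1} = {-1<..<1} \<inter> A" by auto
  finally show ?thesis using A by (simp add: emeasure_unif)
qed

lemma circle_abelian_compact_group: "abelian_compact_group circle_group circle_topology"
proof -
  interpret compact_group circle_group circle_topology by (rule circle_compact_group)
  have "comm_group circle_group"
    by (rule group_comm_groupI) (auto simp: carrier_circle_group circle_proj_mult add.commute)
  moreover have "second_countable circle_topology"
    using second_countable_open_map_image[OF quotient_imp_continuous_map[OF quotient_map_circle_proj]
        open_map_circle_proj _ second_countable_euclidean]
    by (simp add: topspace_circle_topology carrier_circle_group)
  ultimately show ?thesis
    by (intro abelian_compact_group.intro abelian_compact_group_axioms.intro circle_compact_group)
qed

lemma continuous_circle_proj: "continuous_map euclidean circle_topology circle_proj"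
  by (rule quotient_imp_continuous_map[OF quotient_map_circle_proj])

lemma measurable_circle_proj: "circle_proj \<in> borel \<rightarrow>\<^sub>M borel_of circle_topology"
  using measurable_continuous_map[OF continuous_circle_proj] by (simp add: borel_of_euclidean)

text \<open>Shifting by \<open>s\<close> replaces the window [-1, 1) by [s - 1, s + 1). The part
  beyond 1 is moved back by the period 2 onto the missing piece [-1, s - 1).\<close>

lemma emeasure_unif_periodic:
  assumes A [measurable]: "A \<in> sets borel" and period: "\<And>t. t + 2 \<in> A \<longleftrightarrow> t \<in> A"
    and s: "0 \<le> s" "s < 1"
  shows "emeasure unif ((\<lambda>t. s + t) -` A) = emeasure unif A"
proof -
  have pre: "(\<lambda>t. c + t) -` B \<in> sets borel" if "B \<in> sets borel" for c :: real and B
    using measurable_sets[of "\<lambda>t. c + t" borel borel B] that by simp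
  have "{-1..<1} \<inter> (\<lambda>t. s + t) -` A = (\<lambda>t. s + t) -` ({s-1..<s+1} \<inter> A)" by auto
  then have "emeasure lborel ({-1..<1} \<inter> (\<lambda>t. s + t) -` A) = emeasure lborel ({s-1..<s+1} \<inter> A)"
    using emeasure_lborel_translation[of "{s-1..<s+1} \<inter> A" s] by simp
  also have "{s-1..<s+1} \<inter> A = ({s-1..<1} \<inter> A) \<union> ({1..<s+1} \<inter> A)"
    using s by auto
  also have "emeasure lborel \<dots> = emeasure lborel ({s-1..<1} \<inter> A) + emeasure lborel ({1..<s+1} \<inter> A)"
    by (rule plus_emeasure[symmetric]) auto
  also have "emeasure lborel ({1..<s+1} \<inter> A) = emeasure lborel ((\<lambda>t. 2 + t) -` ({1..<s+1} \<inter> A))"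
    using emeasure_lborel_translation[of "{1..<s+1} \<inter> A" 2] by simp
  also have "(\<lambda>t. 2 + t) -` ({1..<s+1} \<inter> A) = {-1..<s-1} \<inter> A"
    using period by (auto simp: add.commute)
  also have "emeasure lborel ({s-1..<1} \<inter> A) + emeasure lborel ({-1..<s-1} \<inter> A)
      = emeasure lborel (({s-1..<1} \<inter> A) \<union> ({-1..<s-1} \<inter> A))"
    by (rule plus_emeasure) auto
  also have "({s-1..<1} \<inter> A) \<union> ({-1..<s-1} \<inter> A) = {-1..<1} \<inter> A"
    using s by auto
  finally show ?thesis
    by (simp add: emeasure_unif_Ico pre)
qed

lemma is_haar_prob_circle:
  "is_haar_prob circle_group circle_topology (distr unif (borel_of circle_topology) circle_proj)"
proof (rule is_haar_prob_distr)
  interpret abelian_compact_group circle_group circle_topology by (rule circle_abelian_compact_group)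
  show "prob_space unif" "sets unif = sets borel" by (auto simp: prob_space_unif)
  show "continuous_map euclidean circle_topology circle_proj" by (rule continuous_circle_proj)
  show "Hausdorff_space circle_topology" by (rule Hausdorff)
  fix g assume g: "g \<in> carrier circle_group"
  \<comment> \<open>The fractional part supplies a representative in the range that
    \<open>emeasure_unif_periodic\<close> allows.\<close>
  obtain s where s: "0 \<le> s" "s < 1" "g = circle_proj s"
  proof -
    obtain t where "g = circle_proj t" using g by (auto simp: carrier_circle_group)
    then have "g = circle_proj (frac t)" by (simp add: circle_proj_eq_iff frac_def)
    then show ?thesis using that frac_ge_0 frac_lt_1 by blast
  qed
  let ?m = "distr unif (borel_of circle_topology) circle_proj"
  have meas: "circle_proj \<in> unif \<rightarrow>\<^sub>M borel_of circle_topology"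
    using measurable_circle_proj by simp
  show "distr ?m (borel_of circle_topology) (\<lambda>x. g \<otimes>\<^bsub>circle_group\<^esub> x) = ?m"
  proof (rule measure_eqI)
    fix A assume "A \<in> sets (distr ?m (borel_of circle_topology) (\<lambda>x. g \<otimes>\<^bsub>circle_group\<^esub> x))"
    then have A: "A \<in> sets (borel_of circle_topology)" by simp
    have "emeasure (distr ?m (borel_of circle_topology) (\<lambda>x. g \<otimes>\<^bsub>circle_group\<^esub> x)) A
        = emeasure unif ((\<lambda>t. g \<otimes>\<^bsub>circle_group\<^esub> circle_proj t) -` A)"
      using A meas measurable_translation[OF g]
      by (simp add: distr_distr emeasure_distr o_def measurable_compose[OF meas])
    also have "\<dots> = emeasure unif ((\<lambda>t. s + t) -` (circle_proj -` A))"
      by (simp add: s circle_proj_mult vimage_def)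
    also have "\<dots> = emeasure unif (circle_proj -` A)"
    proof (rule emeasure_unif_periodic)
      show "circle_proj -` A \<in> sets borel"
        using measurable_sets[OF measurable_circle_proj A] by simp
      have "circle_proj (t + 2) = circle_proj t" for t
        by (simp add: circle_proj_eq_iff)
      then show "t + 2 \<in> circle_proj -` A \<longleftrightarrow> t \<in> circle_proj -` A" for t by simp
    qed (use s in auto)
    also have "\<dots> = emeasure ?m A"
      using A meas by (simp add: emeasure_distr)
    finally show "emeasure (distr ?m (borel_of circle_topology) (\<lambda>x. g \<otimes>\<^bsub>circle_group\<^esub> x)) A = emeasure ?m A" .
  qed simp
qed

section \<open>Characters of the circle\<close>

definition circle_char :: "int \<Rightarrow> real set \<Rightarrow> complex" where
  "circle_char n y = cis (2 * pi * of_int n * (SOME t. y = circle_proj t))"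

text \<open>The chosen representative differs from \<open>t\<close> by an integer, and since
  \<open>n\<close> is an integer this changes the angle by a multiple of 2 pi.\<close>

lemma circle_char_proj: "circle_char n (circle_proj t) = cis (2 * pi * of_int n * t)"
proof -
  define u where "u = (SOME u. circle_proj t = circle_proj u)"
  have "circle_proj t = circle_proj u"
    unfolding u_def by (rule someI[of _ t]) simp
  then obtain k where "t = u + of_int k"
    by (metis Ints_cases add.commute circle_proj_eq_iff diff_add_cancel)
  then have "cis (2 * pi * of_int n * t) = cis (2 * pi * of_int n * u) * cis (2 * pi * of_int (n * k))"
    by (simp add: cis_mult algebra_simps)
  then show ?thesis
    by (simp add: circle_char_def u_def cis_multiple_2pi)
qed

lemma measurable_circle_char: "circle_char n \<in> borel_measurable (borel_of circle_topology)"
proof -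
  have "continuous_map euclidean euclidean (circle_char n \<circ> circle_proj)"
    by (auto simp: o_def circle_char_proj intro!: continuous_intros)
  then have "continuous_map circle_topology euclidean (circle_char n)"
    by (rule continuous_compose_quotient_map[OF quotient_map_circle_proj])
  from measurable_continuous_map[OF this] show ?thesis
    by (simp add: borel_of_euclidean)
qed

section \<open>Haar measure on the p-adic integers\<close>

lemma padic_carrierD:
  assumes "x \<in> padic_carrier p"
  shows "0 \<le> x n" "x n < int p ^ n" "m \<le> n \<Longrightarrow> x n mod int p ^ m = x m"
proof -
  show *: "0 \<le> x n" "x n < int p ^ n" for n
    using assms by (auto simp: padic_carrier_def)
  show "x n mod int p ^ m = x m" if "m \<le> n"
    using that
  proof (induction rule: dec_induct)
    case (step n)
    have "x (Suc n) mod int p ^ m = x (Suc n) mod int p ^ n mod int p ^ m"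
      using step by (simp add: mod_mod_cancel le_imp_power_dvd)
    also have "\<dots> = x m"
      using assms step by (simp add: padic_carrier_def)
    finally show ?case .
  qed (simp add: *)
qed

lemma carrier_padic [simp]: "carrier (padic_group p) = padic_carrier p"
  by (simp add: padic_group_def)

lemma topspace_padic [simp]: "topspace (padic_topology p) = padic_carrier p"
  by (simp add: padic_topology_def)

lemma padic_mult: "x \<otimes>\<^bsub>padic_group p\<^esub> y = (\<lambda>n. (x n + y n) mod int p ^ n)"
  by (simp add: padic_group_def)

lemma padic_inv:
  assumes "prime p" "x \<in> padic_carrier p"
  shows "inv\<^bsub>padic_group p\<^esub> x = (\<lambda>n. (- x n) mod int p ^ n)"
proof -
  interpret compact_group "padic_group p" "padic_topology p"
    by (rule padic_compact_group[OF assms(1)])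
  have p: "p > 0" using assms(1) by (simp add: prime_gt_0_nat)
  show ?thesis
  proof
    fix n
    let ?y = "inv\<^bsub>padic_group p\<^esub> x"
    have y: "?y \<in> padic_carrier p"
      using inv_closed[of x] assms(2) by simp
    have "(?y n + x n) mod int p ^ n = 0"
      using fun_cong[OF l_inv[of x], of n] assms(2) by (simp add: padic_mult, simp add: padic_group_def)
    then have "(- x n) mod int p ^ n = ((?y n + x n) mod int p ^ n + (- x n)) mod int p ^ n"
      by simp
    also have "\<dots> = ?y n mod int p ^ n"
      by (simp only: mod_add_left_eq) simp
    also have "\<dots> = ?y n"
      using padic_carrierD(1,2)[OF y, of n] by simp
    finally show "?y n = (- x n) mod int p ^ n" by simp
  qed
qed

section \<open>Cylinder sets: cosets of p^n Z_p as a base and a generator\<close>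

definition cylinder :: "nat \<Rightarrow> nat \<Rightarrow> int \<Rightarrow> (nat \<Rightarrow> int) set" where
  "cylinder p n a = {x \<in> padic_carrier p. x n = a}"

lemma continuous_padic_coordinate:
  "continuous_map (padic_topology p) (discrete_topology UNIV) (\<lambda>x. x n)"
  unfolding padic_topology_def
  by (intro continuous_map_from_subtopology continuous_map_product_projection) auto

lemma openin_cylinder: "openin (padic_topology p) (cylinder p n a)"
proof -
  from openin_continuous_map_preimage[OF continuous_padic_coordinate[of p n], of "{a}"] show ?thesis
    by (simp add: cylinder_def)
qed

text \<open>A basic open set restricts finitely many coordinates, all of index at most some
  \<open>k\<close>, and coordinate \<open>e k\<close> determines these by reduction. The level
  function \<open>e\<close> is free because the identity serves for second countability and squaring
  for the Haar measure.\<close>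

lemma cylinder_neighbourhood:
  assumes "openin (padic_topology p) U" "x \<in> U" and e: "\<And>n. n \<le> e n"
  obtains k where "cylinder p (e k) (x (e k)) \<subseteq> U"
proof -
  let ?P = "product_topology (\<lambda>_::nat. discrete_topology (UNIV :: int set)) UNIV"
  obtain V where V: "openin ?P V" "U = V \<inter> padic_carrier p"
    using assms(1) by (auto simp: padic_topology_def openin_subtopology)
  obtain X where X: "x \<in> Pi\<^sub>E UNIV X" "finite {i. X i \<noteq> UNIV}" "Pi\<^sub>E UNIV X \<subseteq> V"
    using product_topology_open_contains_basis[OF V(1), of x] assms(2) V(2) by auto
  obtain k where k: "\<And>i. X i \<noteq> UNIV \<Longrightarrow> i \<le> k"
    using X(2) unfolding finite_nat_set_iff_bounded_le by blast
  have "cylinder p (e k) (x (e k)) \<subseteq> U"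
  proof
    fix y assume "y \<in> cylinder p (e k) (x (e k))"
    then have y: "y \<in> padic_carrier p" "y (e k) = x (e k)" by (auto simp: cylinder_def)
    have x: "x \<in> padic_carrier p" using assms(2) V by blast
    have "y i \<in> X i" for i
    proof (cases "X i = UNIV")
      case False
      then have "i \<le> e k" using k e[of k] order_trans by blast
      then have "y i = x i"
        using padic_carrierD(3)[OF x] padic_carrierD(3)[OF y(1)] y(2) by metis
      then show ?thesis using X(1) by auto
    qed simp
    then show "y \<in> U" using X(3) V(2) y(1) by auto
  qed
  then show thesis by (rule that)
qed

lemma second_countable_padic: "second_countable (padic_topology p)"
  unfolding second_countable_def
proof (intro exI[of _ "range (\<lambda>(n, a). cylinder p n a)"] conjI allI impI)
  fix U x assume "openin (padic_topology p) U \<and> x \<in> U"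
  then have U: "openin (padic_topology p) U" "x \<in> U" by auto
  obtain n where "cylinder p n (x n) \<subseteq> U"
    using cylinder_neighbourhood[OF U, of "\<lambda>n. n"] by auto
  moreover have "x \<in> cylinder p n (x n)"
    using openin_subset[OF U(1)] U(2) by (auto simp: cylinder_def)
  ultimately show "\<exists>V\<in>range (\<lambda>(n, a). cylinder p n a). x \<in> V \<and> V \<subseteq> U"
    by (intro bexI[of _ "cylinder p n (x n)"]) auto
qed (auto simp: openin_cylinder)

lemma padic_abelian_compact_group:
  assumes "prime p"
  shows "abelian_compact_group (padic_group p) (padic_topology p)"
proof -
  interpret compact_group "padic_group p" "padic_topology p"
    by (rule padic_compact_group[OF assms])
  have "comm_group (padic_group p)"
    by (rule group_comm_groupI) (simp add: padic_mult add.commute)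
  moreover have "second_countable (padic_topology p)"
    by (rule second_countable_padic)
  ultimately show ?thesis
    by (intro abelian_compact_group.intro abelian_compact_group_axioms.intro padic_compact_group assms)
qed

text \<open>There are only countably many cylinders, so every open set is a countable union of those
  at the levels \<open>e k\<close>.\<close>

lemma sets_borel_of_padic:
  assumes e: "\<And>n. n \<le> e n"
  shows "sets (borel_of (padic_topology p))
    = sigma_sets (padic_carrier p) (range (\<lambda>(k, a). cylinder p (e k) a))"
    (is "_ = sigma_sets _ ?E")
proof -
  have "U \<in> sigma_sets (padic_carrier p) ?E" if U: "openin (padic_topology p) U" for U
  proof -
    let ?I = "{(k, a). cylinder p (e k) a \<subseteq> U}"
    have sub: "U \<subseteq> padic_carrier p" using openin_subset[OF U] by simp
    have "x \<in> (\<Union>(k, a)\<in>?I. cylinder p (e k) a)" if x: "x \<in> U" for x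
    proof -
      obtain k where "cylinder p (e k) (x (e k)) \<subseteq> U"
        using cylinder_neighbourhood[OF U x e] .
      moreover have "x \<in> cylinder p (e k) (x (e k))"
        using x sub by (auto simp: cylinder_def)
      ultimately show ?thesis by blast
    qed
    then have "U = (\<Union>(k, a)\<in>?I. cylinder p (e k) a)" by blast
    also have "\<dots> \<in> sigma_sets (padic_carrier p) ?E"
      by (rule sigma_sets_UNION) auto
    finally show ?thesis .
  qed
  then have "sigma_sets (padic_carrier p) {U. openin (padic_topology p) U} \<subseteq> sigma_sets (padic_carrier p) ?E"
    by (intro sigma_sets_mono) auto
  moreover have "sigma_sets (padic_carrier p) ?E \<subseteq> sigma_sets (padic_carrier p) {U. openin (padic_topology p) U}"
    by (intro sigma_sets_mono') (auto simp: openin_cylinder)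
  ultimately show ?thesis
    by (simp add: sets_borel_of)
qed

text \<open>Two cylinders are nested or disjoint, since the coordinate at the higher level
  determines the one at the lower level.\<close>

lemma Int_stable_cylinders:
  assumes e: "\<And>n. n \<le> e n"
  shows "Int_stable (range (\<lambda>(k, a). cylinder p (e k) a))"
proof (rule Int_stableI)
  let ?E = "range (\<lambda>(k, a). cylinder p (e k) a)"
  \<comment> \<open>The out-of-range residue -1 makes the empty set a cylinder, which covers the
    disjoint case.\<close>
  have empty: "{} \<in> ?E"
  proof (rule image_eqI)
    have "x n \<noteq> -1" if "x \<in> padic_carrier p" for x n
      using padic_carrierD(1)[OF that, of n] by simp
    then show "{} = (case (0, -1) of (k, a) \<Rightarrow> cylinder p (e k) a)"
      by (auto simp: cylinder_def)
  qed simp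
  have *: "cylinder p m a \<inter> cylinder p n b \<in> {cylinder p n b, {}}" if "m \<le> n" for m n a b
  proof -
    have *: "x m = x n mod int p ^ m" if "x \<in> padic_carrier p" for x
      using padic_carrierD(3)[OF that \<open>m \<le> n\<close>] by simp
    show ?thesis
      by (cases "b mod int p ^ m = a") (auto simp: cylinder_def *)
  qed
  fix A B assume "A \<in> ?E" "B \<in> ?E"
  then obtain k a l b where AB: "A = cylinder p (e k) a" "B = cylinder p (e l) b" by auto
  have "A \<in> ?E" "B \<in> ?E" using AB by auto
  moreover have "A \<inter> B \<in> {A, B, {}}"
    using *[of "e k" "e l" a b] *[of "e l" "e k" b a] unfolding AB by (cases "e k \<le> e l") (auto simp: Int_commute)
  ultimately show "A \<inter> B \<in> ?E" using empty by auto
qed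

text \<open>Translation permutes the nonempty cylinders of each level, so equal masses within a
  level make both measures agree on an intersection-stable generator.\<close>

lemma padic_translation_invariantI:
  assumes p: "prime p" and m: "prob_space m" "sets m = sets (borel_of (padic_topology p))"
    and e: "\<And>n. n \<le> e n"
    and cyl: "\<And>k a b. \<lbrakk>0 \<le> a; a < int p ^ e k; 0 \<le> b; b < int p ^ e k\<rbrakk>
        \<Longrightarrow> emeasure m (cylinder p (e k) a) = emeasure m (cylinder p (e k) b)"
    and g: "g \<in> padic_carrier p"
  shows "distr m (borel_of (padic_topology p)) (\<lambda>x. g \<otimes>\<^bsub>padic_group p\<^esub> x) = m"
proof (rule measure_eqI_generator_eq_countable)
  let ?E = "range (\<lambda>(k, a). cylinder p (e k) a)"
  interpret abelian_compact_group "padic_group p" "padic_topology p"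
    by (rule padic_abelian_compact_group[OF p])
  interpret m: prob_space m by fact
  have p0: "p > 0" using p by (simp add: prime_gt_0_nat)
  have sp: "space m = padic_carrier p"
    using sets_eq_imp_space_eq[OF m(2)] by simp
  have meas: "(\<lambda>x. g \<otimes>\<^bsub>padic_group p\<^esub> x) \<in> m \<rightarrow>\<^sub>M borel_of (padic_topology p)"
    using measurable_translation[of g] g by (simp add: measurable_cong_sets[OF m(2) refl])
  show "Int_stable ?E" using Int_stable_cylinders[OF e] .
  show "?E \<subseteq> Pow (padic_carrier p)" by (auto simp: cylinder_def)
  fix X assume "X \<in> ?E"
  then obtain k a where X: "X = cylinder p (e k) a" by auto
  then have X_sets: "X \<in> sets (borel_of (padic_topology p))"
    by (simp add: openin_borel_of openin_cylinder)
  show "emeasure (distr m (borel_of (padic_topology p)) (\<lambda>x. g \<otimes>\<^bsub>padic_group p\<^esub> x)) X = emeasure m X"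
  proof (cases "0 \<le> a \<and> a < int p ^ e k")
    \<comment> \<open>No coordinate takes the value \<open>a\<close>, so the cylinder is
      empty.\<close>
    case False
    then have "X = {}" using padic_carrierD(1,2) by (fastforce simp: X cylinder_def)
    then show ?thesis by simp
  next
    case True
    have shift: "(g (e k) + c) mod int p ^ e k = a \<longleftrightarrow> c = (a - g (e k)) mod int p ^ e k"
      if "0 \<le> c" "c < int p ^ e k" for c
    proof
      assume "(g (e k) + c) mod int p ^ e k = a"
      then have "(a - g (e k)) mod int p ^ e k = (g (e k) + c - g (e k)) mod int p ^ e k"
        by (metis mod_diff_left_eq)
      then show "c = (a - g (e k)) mod int p ^ e k" using that by simp
    next
      assume "c = (a - g (e k)) mod int p ^ e k"
      then have "(g (e k) + c) mod int p ^ e k = (g (e k) + (a - g (e k))) mod int p ^ e k"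
        by (simp only: mod_add_right_eq)
      then show "(g (e k) + c) mod int p ^ e k = a" using True by simp
    qed
    have "g \<otimes>\<^bsub>padic_group p\<^esub> x \<in> X \<longleftrightarrow> x \<in> cylinder p (e k) ((a - g (e k)) mod int p ^ e k)"
      if "x \<in> padic_carrier p" for x
      using shift[OF padic_carrierD(1,2)[OF that]] m_closed[of g x] g that
      by (simp add: X cylinder_def padic_mult)
    then have "(\<lambda>x. g \<otimes>\<^bsub>padic_group p\<^esub> x) -` X \<inter> padic_carrier p
        = cylinder p (e k) ((a - g (e k)) mod int p ^ e k)"
      by (auto simp: cylinder_def)
    then have "emeasure (distr m (borel_of (padic_topology p)) (\<lambda>x. g \<otimes>\<^bsub>padic_group p\<^esub> x)) X
        = emeasure m (cylinder p (e k) ((a - g (e k)) mod int p ^ e k))"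
      using emeasure_distr[OF meas X_sets] by (simp add: sp)
    also have "\<dots> = emeasure m X"
      unfolding X by (rule cyl) (use True p0 in auto)
    finally show ?thesis .
  qed
next
  show "sets (distr m (borel_of (padic_topology p)) (\<lambda>x. g \<otimes>\<^bsub>padic_group p\<^esub> x))
      = sigma_sets (padic_carrier p) (range (\<lambda>(k, a). cylinder p (e k) a))"
    "sets m = sigma_sets (padic_carrier p) (range (\<lambda>(k, a). cylinder p (e k) a))"
    by (simp_all add: m(2) sets_borel_of_padic[OF e])
  \<comment> \<open>The cylinders of the single level \<open>e 0\<close> form the countable cover
    that the uniqueness theorem asks for.\<close>
  show "range (\<lambda>a. cylinder p (e 0) a) \<subseteq> range (\<lambda>(k, a). cylinder p (e k) a)" by auto
  show "\<Union> (range (\<lambda>a. cylinder p (e 0) a)) = padic_carrier p" by (auto simp: cylinder_def)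
  interpret m: prob_space m by fact
  interpret abelian_compact_group "padic_group p" "padic_topology p"
    by (rule padic_abelian_compact_group[OF p])
  have "prob_space (distr m (borel_of (padic_topology p)) (\<lambda>x. g \<otimes>\<^bsub>padic_group p\<^esub> x))"
    using measurable_translation[of g] g
    by (intro m.prob_space_distr) (simp add: measurable_cong_sets[OF m(2) refl])
  then show "emeasure (distr m (borel_of (padic_topology p)) (\<lambda>x. g \<otimes>\<^bsub>padic_group p\<^esub> x)) a \<noteq> \<infinity>" for a
    by (intro finite_measure.emeasure_finite[unfolded infinity_ennreal_def[symmetric]]) (simp add: prob_space_def)
qed simp

section \<open>The coupling\<close>

text \<open>The floor drops the base p digits after position (j + 1)^2, and the reduction drops
  those up to position j^2. Negative \<open>t\<close> has its own branch because the floor is not an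
  odd function.\<close>

definition block_digit :: "nat \<Rightarrow> real \<Rightarrow> nat \<Rightarrow> int" where
  "block_digit p t j =
     (if 0 \<le> t then \<lfloor>real p ^ (Suc j)\<^sup>2 * t\<rfloor> mod int p ^ (2 * j + 1)
      else - (\<lfloor>real p ^ (Suc j)\<^sup>2 * (- t)\<rfloor> mod int p ^ (2 * j + 1)))"

text \<open>As \<open>n \<le> n\<^sup>2\<close>, the terms with \<open>j \<ge> n\<close> of the series vanish modulo \<open>p\<^sup>n\<close>.\<close>

definition padic_of_digits :: "nat \<Rightarrow> (nat \<Rightarrow> int) \<Rightarrow> nat \<Rightarrow> int" where
  "padic_of_digits p d n = (\<Sum>j<n. d j * int p ^ j\<^sup>2) mod int p ^ n"

abbreviation padic_of :: "nat \<Rightarrow> real \<Rightarrow> nat \<Rightarrow> int" where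
  "padic_of p t \<equiv> padic_of_digits p (block_digit p t)"

lemma le_square: "n \<le> n\<^sup>2" for n :: nat
  by (simp add: power2_eq_square)

lemma power_Suc_square: "x ^ (Suc k)\<^sup>2 = x ^ k\<^sup>2 * x ^ (2 * k + 1)" for x :: "'a::monoid_mult"
proof -
  have "(Suc k)\<^sup>2 = k\<^sup>2 + (2 * k + 1)" by (simp add: power2_eq_square)
  then show ?thesis by (simp only: power_add)
qed

text \<open>Passing from \<open>n\<close> to \<open>Suc n\<close> adds one term, a multiple of
  p^(n^2) and so of p^n; this gives coherence.\<close>

lemma padic_of_digits_carrier:
  assumes "p > 0" shows "padic_of_digits p d \<in> padic_carrier p"
proof -
  have "padic_of_digits p d (Suc n) mod int p ^ n = padic_of_digits p d n" for n
  proof -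
    have "padic_of_digits p d (Suc n) mod int p ^ n
        = ((\<Sum>j<n. d j * int p ^ j\<^sup>2) + d n * int p ^ n\<^sup>2) mod int p ^ n"
      by (simp add: padic_of_digits_def mod_mod_cancel)
    also have "\<dots> = padic_of_digits p d n"
    proof -
      have "int p ^ n dvd d n * int p ^ n\<^sup>2"
        by (intro dvd_mult le_imp_power_dvd le_square)
      then show ?thesis
        by (metis add.right_neutral dvd_imp_mod_0 mod_add_right_eq padic_of_digits_def)
    qed
    finally show ?thesis .
  qed
  moreover have "padic_of_digits p d n \<in> {0..<int p ^ n}" for n
    using assms by (simp add: padic_of_digits_def)
  ultimately show ?thesis by (simp add: padic_carrier_def)
qed

text \<open>At a square level the terms with \<open>j \<ge> k\<close> vanish modulo p^(k^2), so
  exactly \<open>k\<close> blocks remain.\<close>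

lemma padic_of_digits_square:
  "padic_of_digits p d (k\<^sup>2) = (\<Sum>j<k. d j * int p ^ j\<^sup>2) mod int p ^ k\<^sup>2"
proof -
  have "(\<Sum>j<k\<^sup>2. d j * int p ^ j\<^sup>2) = (\<Sum>j<k. d j * int p ^ j\<^sup>2) + (\<Sum>j\<in>{k..<k\<^sup>2}. d j * int p ^ j\<^sup>2)"
    using sum.atLeastLessThan_concat[of 0 k "k\<^sup>2" "\<lambda>j. d j * int p ^ j\<^sup>2"] le_square[of k]
    by (simp add: atLeast0LessThan)
  moreover have "int p ^ k\<^sup>2 dvd (\<Sum>j\<in>{k..<k\<^sup>2}. d j * int p ^ j\<^sup>2)"
    by (intro dvd_sum dvd_mult le_imp_power_dvd power_mono) auto
  ultimately show ?thesis
    unfolding padic_of_digits_def by (auto elim!: dvdE)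
qed

text \<open>The type \<open>int\<close> carries no metric in the library; \<open>int discrete\<close> makes the space of digit
  sequences Polish, as inner regularity of the image measures requires.\<close>

lemma continuous_padic_of_digits:
  assumes "p > 0"
  shows "continuous_map euclidean (padic_topology p) (\<lambda>d. padic_of_digits p (\<lambda>j. of_discrete (d j)))"
proof -
  have "continuous_map euclidean (discrete_topology UNIV)
      (\<lambda>d. padic_of_digits p (\<lambda>j. of_discrete (d j)) n)" (is "continuous_map _ _ ?f") for n
  proof -
    have "open (?f -` U)" for U
    proof (rule Topological_Spaces.openI)
      fix d assume d: "d \<in> ?f -` U"
      \<comment> \<open>Coordinate \<open>n\<close> of the image depends only on the first
        \<open>n\<close> digits, so freezing these gives a neighbourhood on which it is
        constant.\<close>
      let ?N = "\<Inter>j\<in>{..<n}. (\<lambda>d'. d' j) -` {d j}"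
      have "open ?N"
      proof (intro open_INT ballI open_vimage)
        show "continuous_on UNIV (\<lambda>d' :: nat \<Rightarrow> int discrete. d' j)" for j
          by (rule continuous_on_product_coordinates)
      qed (simp_all add: open_discrete)
      moreover have "?N \<subseteq> ?f -` U"
      proof
        fix d' assume "d' \<in> ?N"
        then have "\<And>j. j < n \<Longrightarrow> d' j = d j" by blast
        then have "?f d' = ?f d"
          unfolding padic_of_digits_def by (metis (no_types, lifting) lessThan_iff sum.cong)
        then show "d' \<in> ?f -` U" using d by simp
      qed
      ultimately show "\<exists>T. open T \<and> d \<in> T \<and> T \<subseteq> ?f -` U"
        by (intro exI[of _ ?N]) auto
    qed
    then show ?thesis
      by (simp add: continuous_map_def vimage_def)
  qed
  then show ?thesis
    using padic_of_digits_carrier[OF assms]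
    by (simp add: padic_topology_def continuous_map_in_subtopology continuous_map_componentwise_UNIV)
qed

section \<open>Block expansions and residues modulo p^(k^2)\<close>

lemma block_digit_uminus: "block_digit p (- t) j = - block_digit p t j"
  by (cases "t = 0") (auto simp: block_digit_def)

lemma padic_of_uminus:
  assumes "prime p" shows "padic_of p (- t) = inv\<^bsub>padic_group p\<^esub> padic_of p t"
proof -
  have "(- (\<Sum>j<n. block_digit p t j * int p ^ j\<^sup>2)) mod int p ^ n
      = (- ((\<Sum>j<n. block_digit p t j * int p ^ j\<^sup>2) mod int p ^ n)) mod int p ^ n" for n
    by (simp only: mod_minus_eq)
  then show ?thesis
    using padic_of_digits_carrier[OF prime_gt_0_nat[OF assms], of "block_digit p t"]
    by (simp add: padic_inv[OF assms])
      (simp add: padic_of_digits_def block_digit_uminus sum_negf fun_eq_iff)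
qed

lemma block_digit_bounds:
  assumes "p > 0" "0 \<le> t"
  shows "0 \<le> block_digit p t j" "block_digit p t j < int p ^ (2 * j + 1)"
  using assms by (simp_all add: block_digit_def)

text \<open>This is a mixed radix expansion: block \<open>j\<close> is below p^(2 j + 1), and this
  radix times the weight p^(j^2) is the next weight. Hence there are no carries, and reduction
  modulo p^(k^2) leaves the sum of the first \<open>k\<close> blocks unchanged.\<close>

lemma digit_sum_bounds:
  assumes "p > 0" "0 \<le> t"
  shows "0 \<le> (\<Sum>j<k. block_digit p t j * int p ^ j\<^sup>2)"
    "(\<Sum>j<k. block_digit p t j * int p ^ j\<^sup>2) < int p ^ k\<^sup>2"
proof -
  show "0 \<le> (\<Sum>j<k. block_digit p t j * int p ^ j\<^sup>2)"
    using block_digit_bounds[OF assms] by (intro sum_nonneg) simp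
  show "(\<Sum>j<k. block_digit p t j * int p ^ j\<^sup>2) < int p ^ k\<^sup>2"
  proof (induction k)
    case (Suc k)
    have "block_digit p t k * int p ^ k\<^sup>2 \<le> (int p ^ (2 * k + 1) - 1) * int p ^ k\<^sup>2"
      using block_digit_bounds(2)[OF assms, of k] by (intro mult_right_mono) auto
    also have "\<dots> = int p ^ (Suc k)\<^sup>2 - int p ^ k\<^sup>2"
      by (simp only: power_Suc_square) (simp add: algebra_simps)
    finally show ?case using Suc.IH by simp
  qed simp
qed

lemma padic_of_square:
  assumes "p > 0" "0 \<le> t"
  shows "padic_of p t (k\<^sup>2) = (\<Sum>j<k. block_digit p t j * int p ^ j\<^sup>2)"
  using digit_sum_bounds[OF assms, of k] by (simp add: padic_of_digits_square)

text \<open>Integer division removes the last 2 k + 1 base p digits, that is, block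
  \<open>k\<close>.\<close>

lemma floor_block:
  "\<lfloor>real p ^ k\<^sup>2 * t\<rfloor> = \<lfloor>real p ^ (Suc k)\<^sup>2 * t\<rfloor> div int p ^ (2 * k + 1)" if "p > 0"
proof -
  have "real p ^ k\<^sup>2 * t = real p ^ (Suc k)\<^sup>2 * t / real_of_int (int p ^ (2 * k + 1))"
    using that by (simp only: power_Suc_square) simp
  then show ?thesis
    by (simp only: floor_divide_real_eq_div zero_le_power of_nat_0_le_iff)
qed

lemma add_mult_eq_iff:
  fixes s b a Q :: int
  assumes "0 \<le> s" "s < Q"
  shows "s + b * Q = a \<longleftrightarrow> s = a mod Q \<and> b = a div Q"
  using assms by auto

text \<open>Both the residue of the p-adic integer and the floor encode the first \<open>k\<close>
  blocks of \<open>t\<close>, with the order of the blocks reversed. So each residue class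
  corresponds to one value of the floor; which one is irrelevant for its measure.\<close>

lemma padic_of_eq_iff_floor:
  assumes "p > 0" "0 \<le> a" "a < int p ^ k\<^sup>2"
  shows "\<exists>N. 0 \<le> N \<and> N < int p ^ k\<^sup>2 \<and>
    (\<forall>t. 0 \<le> t \<and> t < 1 \<longrightarrow> (padic_of p t (k\<^sup>2) = a \<longleftrightarrow> \<lfloor>real p ^ k\<^sup>2 * t\<rfloor> = N))"
  using assms(2,3)
proof (induction k arbitrary: a)
  case 0
  have "\<lfloor>t\<rfloor> = 0" if "0 \<le> t" "t < 1" for t :: real
    using that by linarith
  with 0 show ?case
    by (intro exI[of _ 0]) (auto simp: padic_of_digits_def)
next
  case (Suc k)
  define Q q where "Q = int p ^ k\<^sup>2" and "q = int p ^ (2 * k + 1)"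
  have pos: "Q > 0" "q > 0" using assms(1) by (simp_all add: Q_def q_def)
  have Qq: "int p ^ (Suc k)\<^sup>2 = Q * q"
    by (simp only: power_Suc_square Q_def q_def)
  obtain N' where N': "0 \<le> N'" "N' < Q"
    "\<And>t. 0 \<le> t \<Longrightarrow> t < 1 \<Longrightarrow> padic_of p t (k\<^sup>2) = a mod Q \<longleftrightarrow> \<lfloor>real p ^ k\<^sup>2 * t\<rfloor> = N'"
    using Suc.IH[of "a mod Q"] pos unfolding Q_def[symmetric] by auto
  have b: "0 \<le> a div Q" "a div Q < q"
  proof -
    show "0 \<le> a div Q" using Suc.prems pos by (simp add: pos_imp_zdiv_nonneg_iff)
    have "Q * (a div Q) \<le> a"
      using mult_div_mod_eq[of Q a] pos_mod_sign[OF pos(1), of a] by linarith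
    also have "a < Q * q" using Suc.prems unfolding Qq by simp
    finally show "a div Q < q" using mult_less_cancel_left_pos[OF pos(1)] by blast
  qed
  \<comment> \<open>The new block is the most significant one in the residue and the least
    significant one in the floor: it is the quotient of \<open>a\<close> by \<open>Q\<close>, and it
    is appended below \<open>N'\<close>.\<close>
  have "padic_of p t ((Suc k)\<^sup>2) = a \<longleftrightarrow> \<lfloor>real p ^ (Suc k)\<^sup>2 * t\<rfloor> = N' * q + a div Q"
    if t: "0 \<le> t" "t < 1" for t
  proof -
    let ?s = "padic_of p t (k\<^sup>2)" and ?b = "block_digit p t k" and ?F = "\<lfloor>real p ^ (Suc k)\<^sup>2 * t\<rfloor>"
    have s: "0 \<le> ?s" "?s < Q"
      using digit_sum_bounds[OF assms(1) t(1), of k] by (simp_all add: padic_of_square assms(1) t Q_def)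
    have "padic_of p t ((Suc k)\<^sup>2) = ?s + ?b * Q"
      by (simp add: padic_of_square assms(1) t Q_def del: power_Suc)
    also have "\<dots> = a \<longleftrightarrow> ?s = a mod Q \<and> ?b = a div Q"
      by (rule add_mult_eq_iff[OF s])
    also have "?s = a mod Q \<longleftrightarrow> N' = ?F div q"
      unfolding N'(3)[OF t] floor_block[OF assms(1), of k t] q_def by (rule eq_commute)
    also have "?b = ?F mod q"
      using t by (simp add: block_digit_def q_def)
    also have "N' = ?F div q \<and> ?F mod q = a div Q \<longleftrightarrow> a div Q + N' * q = ?F"
      unfolding add_mult_eq_iff[OF b] by metis
    also have "\<dots> \<longleftrightarrow> ?F = N' * q + a div Q"
      by (metis add.commute)
    finally show ?thesis .
  qed
  moreover have "N' * q + a div Q < Q * q"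
  proof -
    have "N' * q \<le> (Q - 1) * q" using N'(2) pos by (intro mult_right_mono) auto
    then show ?thesis using b by (simp add: algebra_simps)
  qed
  ultimately show ?case
    using N'(1) b pos unfolding Qq by (intro exI[of _ "N' * q + a div Q"]) auto
qed

section \<open>Distribution of the p-adic coordinate\<close>

lemma measurable_block_digit: "(\<lambda>t j. discrete (block_digit p t j)) \<in> borel_measurable borel"
proof (rule measurable_coordinatewise_then_product)
  fix j
  have "(\<lambda>t. block_digit p t j) \<in> borel \<rightarrow>\<^sub>M count_space UNIV"
    unfolding block_digit_def by measurable
  then show "(\<lambda>t. discrete (block_digit p t j)) \<in> borel_measurable borel"
    by (rule measurable_compose) simp
qed

text \<open>The map factors through the digit sequence: reading off the digits is measurable, and
  summing the series is continuous.\<close>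

lemma measurable_padic_of:
  assumes "p > 0" shows "padic_of p \<in> borel \<rightarrow>\<^sub>M borel_of (padic_topology p)"
  using measurable_compose[OF measurable_block_digit
      measurable_continuous_map[OF continuous_padic_of_digits[OF assms], unfolded borel_of_euclidean], of p]
  by (simp add: discrete_inverse)

text \<open>A residue class is attained on one interval of length p^(-k^2) in [0, 1) and, by
  oddness, on the mirror image of another. The value is left unsimplified, as only its independence
  of \<open>a\<close> is used.\<close>

lemma emeasure_unif_padic_of:
  assumes p: "p > 0" and a: "0 \<le> a" "a < int p ^ k\<^sup>2"
  shows "emeasure unif {t. padic_of p t (k\<^sup>2) = a} = ennreal (2 / real p ^ k\<^sup>2) / 2"
proof -
  define Q where "Q = real p ^ k\<^sup>2"
  have Q: "Q > 0" using p by (simp add: Q_def)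
  have half: "\<exists>u. {t \<in> {0..<1}. padic_of p t (k\<^sup>2) = a} = {u..<u + 1 / Q}"
    if a: "0 \<le> a" "a < int p ^ k\<^sup>2" for a
  proof -
    obtain N where N: "0 \<le> N" "N < int p ^ k\<^sup>2"
      "\<And>t. 0 \<le> t \<Longrightarrow> t < 1 \<Longrightarrow> padic_of p t (k\<^sup>2) = a \<longleftrightarrow> \<lfloor>Q * t\<rfloor> = N"
      using padic_of_eq_iff_floor[OF p a] unfolding Q_def by blast
    have "real_of_int (N + 1) \<le> real_of_int (int p ^ k\<^sup>2)"
      using N(2) by (subst of_int_le_iff) simp
    \<comment> \<open>Integrality gains the 1 that keeps the whole interval inside [0, 1).\<close>
    then have NQ: "of_int N + 1 \<le> Q" by (simp add: Q_def)
    have "t \<in> {0..<1} \<and> padic_of p t (k\<^sup>2) = a \<longleftrightarrow> t \<in> {of_int N / Q..<of_int N / Q + 1 / Q}" for t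
    proof
      assume "t \<in> {0..<1} \<and> padic_of p t (k\<^sup>2) = a"
      then have "\<lfloor>Q * t\<rfloor> = N" using N(3) by auto
      then have "of_int N \<le> Q * t" "Q * t < of_int N + 1" by linarith+
      then show "t \<in> {of_int N / Q..<of_int N / Q + 1 / Q}"
        using Q by (simp add: field_simps)
    next
      assume "t \<in> {of_int N / Q..<of_int N / Q + 1 / Q}"
      then have t: "of_int N \<le> Q * t" "Q * t < of_int N + 1"
        using Q by (simp_all add: field_simps)
      moreover have "0 \<le> real_of_int N" using N(1) by simp
      ultimately have "Q * t < Q * 1" "Q * 0 \<le> Q * t" using NQ by linarith+
      then have "t < 1" "0 \<le> t"
        using Q mult_less_cancel_left_pos[OF Q, of t 1] mult_le_cancel_left_pos[OF Q, of 0 t] by blast+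
      moreover have "\<lfloor>Q * t\<rfloor> = N" using t by linarith
      ultimately show "t \<in> {0..<1} \<and> padic_of p t (k\<^sup>2) = a" using N(3) by auto
    qed
    then show ?thesis by blast
  qed
  obtain u where u: "{t \<in> {0..<1}. padic_of p t (k\<^sup>2) = a} = {u..<u + 1 / Q}"
    using half[OF a] by blast
  obtain v where v: "{t \<in> {0..<1}. padic_of p t (k\<^sup>2) = (- a) mod int p ^ k\<^sup>2} = {v..<v + 1 / Q}"
    using half[of "(- a) mod int p ^ k\<^sup>2"] p by auto
  \<comment> \<open>Negative \<open>t\<close> in the class of \<open>a\<close> are reflections of
    positive ones in the class of \<open>- a\<close>.\<close>
  have neg: "padic_of p t (k\<^sup>2) = a \<longleftrightarrow> padic_of p (- t) (k\<^sup>2) = (- a) mod int p ^ k\<^sup>2" for t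
  proof -
    have *: "padic_of p (- t) (k\<^sup>2) = (- padic_of p t (k\<^sup>2)) mod int p ^ k\<^sup>2" for t
      by (simp add: padic_of_digits_def block_digit_uminus sum_negf mod_minus_eq)
    have "padic_of p t (k\<^sup>2) = (- padic_of p (- t) (k\<^sup>2)) mod int p ^ k\<^sup>2"
      using *[of "- t"] by simp
    then show ?thesis
      using * a by (metis mod_minus_eq mod_pos_pos_trivial minus_minus)
  qed
  have mem_u: "t \<in> {u..<u + 1 / Q} \<longleftrightarrow> 0 \<le> t \<and> t < 1 \<and> padic_of p t (k\<^sup>2) = a" for t
    unfolding u[symmetric] by simp
  have mem_v: "- t \<in> {v..<v + 1 / Q} \<longleftrightarrow> t \<le> 0 \<and> -1 < t \<and> padic_of p t (k\<^sup>2) = a" for t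
    unfolding v[symmetric] neg[of t] by auto
  \<comment> \<open>Removing 0 from the second interval makes the union disjoint, since the point 0
    is its own reflection.\<close>
  have "{-1<..<1} \<inter> {t. padic_of p t (k\<^sup>2) = a} = {u..<u + 1 / Q} \<union> uminus -` ({v..<v + 1 / Q} - {0})"
    unfolding set_eq_iff Un_iff Int_iff vimage_eq Diff_iff mem_u mem_v by auto
  moreover have "{u..<u + 1 / Q} \<inter> uminus -` ({v..<v + 1 / Q} - {0}) = {}"
    unfolding set_eq_iff Un_iff Int_iff vimage_eq Diff_iff mem_u mem_v by auto
  moreover have meas: "uminus -` ({v..<v + 1 / Q} - {0}) \<in> sets borel"
    using measurable_sets[of uminus borel borel "{v..<v + 1 / Q} - {0}"] by simp
  ultimately have "emeasure lborel ({-1<..<1} \<inter> {t. padic_of p t (k\<^sup>2) = a})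
      = emeasure lborel {u..<u + 1 / Q} + emeasure lborel (uminus -` ({v..<v + 1 / Q} - {0}))"
    by (simp add: plus_emeasure)
  also have "emeasure lborel (uminus -` ({v..<v + 1 / Q} - {0})) = emeasure lborel ({v..<v + 1 / Q} - {0})"
    by (rule emeasure_lborel_uminus) simp
  also have "\<dots> = emeasure lborel {v..<v + 1 / Q}"
    by (rule emeasure_Diff_null_set) auto
  finally have "emeasure lborel ({-1<..<1} \<inter> {t. padic_of p t (k\<^sup>2) = a}) = ennreal (2 / Q)"
    using Q by (simp flip: ennreal_plus)
  moreover have "{t. padic_of p t (k\<^sup>2) = a} \<in> sets borel"
  proof -
    have "{t. padic_of p t (k\<^sup>2) = a} = padic_of p -` cylinder p (k\<^sup>2) a \<inter> space borel"
      using padic_of_digits_carrier[OF p] by (auto simp: cylinder_def)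
    then show ?thesis
      using measurable_sets[OF measurable_padic_of[OF p] openin_borel_of[OF openin_cylinder]] by simp
  qed
  ultimately show ?thesis
    by (simp add: emeasure_unif Q_def)
qed

text \<open>Both are the same measure. Its direct form is the law needed for the coupling; the form
  through digit sequences exhibits it as a continuous image of a Polish space, as
  \<open>is_haar_prob_distr\<close> and \<open>is_haar_prob_DirProd\<close> demand.\<close>

lemma is_haar_prob_padic_of:
  assumes p: "prime p"
  shows "is_haar_prob (padic_group p) (padic_topology p) (distr unif (borel_of (padic_topology p)) (padic_of p))"
    and "is_haar_prob (padic_group p) (padic_topology p)
      (distr (distr unif borel (\<lambda>t j. discrete (block_digit p t j))) (borel_of (padic_topology p))
        (\<lambda>d. padic_of_digits p (\<lambda>j. of_discrete (d j))))"
proof -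
  let ?T = "padic_topology p" and ?\<phi> = "\<lambda>d. padic_of_digits p (\<lambda>j. of_discrete (d j))"
  let ?\<delta> = "distr unif borel (\<lambda>t j. discrete (block_digit p t j))"
  let ?m = "distr unif (borel_of ?T) (padic_of p)"
  have p0: "p > 0" by (rule prime_gt_0_nat[OF p])
  interpret compact_group "padic_group p" ?T by (rule padic_compact_group[OF p])
  interpret U: prob_space unif by (rule prob_space_unif)
  have meas: "padic_of p \<in> unif \<rightarrow>\<^sub>M borel_of ?T"
    using measurable_padic_of[OF p0] by simp
  have digits: "(\<lambda>t j. discrete (block_digit p t j)) \<in> borel_measurable unif"
    using measurable_block_digit[of p] by simp
  have eq: "distr ?\<delta> (borel_of ?T) ?\<phi> = ?m"
    using measurable_block_digit[of p]
      measurable_continuous_map[OF continuous_padic_of_digits[OF p0], unfolded borel_of_euclidean]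
    by (subst distr_distr) (simp_all add: o_def discrete_inverse)
  have inv: "distr ?m (borel_of ?T) (\<lambda>x. g \<otimes>\<^bsub>padic_group p\<^esub> x) = ?m" if "g \<in> padic_carrier p" for g
  \<comment> \<open>Cylinders at square levels suffice, and at these levels the masses are
    known.\<close>
  proof (rule padic_translation_invariantI[OF p _ _ le_square _ that])
    show "prob_space ?m" using meas by (rule U.prob_space_distr)
    have "emeasure ?m (cylinder p (k\<^sup>2) a) = ennreal (2 / real p ^ k\<^sup>2) / 2"
      if "0 \<le> a" "a < int p ^ k\<^sup>2" for k a
    proof -
      have "padic_of p -` cylinder p (k\<^sup>2) a = {t. padic_of p t (k\<^sup>2) = a}"
        using padic_of_digits_carrier[OF p0] by (auto simp: cylinder_def)
      then show ?thesis
        using emeasure_distr[OF meas openin_borel_of[OF openin_cylinder]] emeasure_unif_padic_of[OF p0 that]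
        by simp
    qed
    then show "emeasure ?m (cylinder p (k\<^sup>2) a) = emeasure ?m (cylinder p (k\<^sup>2) b)"
      if "0 \<le> a" "a < int p ^ k\<^sup>2" "0 \<le> b" "b < int p ^ k\<^sup>2" for k a b
      using that by simp
  qed simp
  show "is_haar_prob (padic_group p) ?T (distr ?\<delta> (borel_of ?T) ?\<phi>)"
    by (rule is_haar_prob_distr)
      (use inv digits in \<open>auto simp: eq Hausdorff continuous_padic_of_digits[OF p0]
        intro!: U.prob_space_distr\<close>)
  then show "is_haar_prob (padic_group p) ?T ?m" by (simp add: eq)
qed

section \<open>Characters\<close>

definition padic_char :: "nat \<Rightarrow> nat \<Rightarrow> (nat \<Rightarrow> int) \<Rightarrow> complex" where
  "padic_char p n x = cis (2 * pi * of_int (x n) / real p ^ n)"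

text \<open>Reducing the sum modulo p^n changes the angle by an integer multiple of 2 pi.\<close>

lemma padic_char_mult:
  assumes "p > 0"
  shows "padic_char p n (x \<otimes>\<^bsub>padic_group p\<^esub> y) = padic_char p n x * padic_char p n y"
proof -
  let ?Q = "int p ^ n" and ?s = "x n + y n"
  have mod: "real_of_int (?s mod ?Q) = of_int ?s - real p ^ n * of_int (?s div ?Q)"
    by (simp flip: minus_mult_div_eq_mod)
  have "2 * pi * of_int (?s mod ?Q) / real p ^ n
      = 2 * pi * of_int (x n) / real p ^ n + 2 * pi * of_int (y n) / real p ^ n - 2 * pi * of_int (?s div ?Q)"
    unfolding mod using assms by (simp add: diff_divide_distrib add_divide_distrib right_diff_distrib distrib_left)
  then show ?thesis
    by (simp add: padic_char_def padic_mult cis_multiple_2pi cis_mult flip: cis_divide)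
qed

lemma measurable_padic_char: "padic_char p n \<in> borel_measurable (borel_of (padic_topology p))"
proof -
  from continuous_map_compose[OF continuous_padic_coordinate[of p n], of euclidean "\<lambda>a. cis (2 * pi * of_int a / real p ^ n)"]
  have "continuous_map (padic_topology p) euclidean (padic_char p n)"
    by (simp add: padic_char_def[abs_def] o_def)
  from measurable_continuous_map[OF this] show ?thesis
    by (simp add: borel_of_euclidean)
qed

text \<open>A chord of the unit circle is at most as long as its arc.\<close>

lemma norm_one_minus_cis: "cmod (1 - cis x) \<le> \<bar>x\<bar>"
proof -
  have "cmod (1 - cis x) = 2 * \<bar>sin (x / 2)\<bar>"
    using dist_exp_i_1[of x] by (simp add: cis_conv_exp norm_minus_commute)
  also have "\<dots> \<le> 2 * \<bar>x / 2\<bar>"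
    by (intro mult_left_mono abs_sin_x_le_abs_x) simp
  finally show ?thesis by simp
qed

section \<open>The coupled characters and their distance from 1\<close>

definition coupled_char :: "nat \<Rightarrow> nat \<Rightarrow> (nat \<Rightarrow> int) \<times> real set \<Rightarrow> complex" where
  "coupled_char p k z = padic_char p ((Suc k)\<^sup>2) (fst z) * circle_char (- (int p ^ k\<^sup>2)) (snd z)"

lemma coupled_char_near_1_nonneg:
  assumes p: "p > 0" and t: "0 \<le> t" "t < 1"
  shows "cmod (1 - coupled_char p k (padic_of p t, circle_proj t)) \<le> 2 * pi / real p ^ (2 * k + 1)"
proof -
  define Q q where "Q = real p ^ k\<^sup>2" and "q = real p ^ (2 * k + 1)"
  define s where "s = padic_of p t (k\<^sup>2)"
  define F where "F = \<lfloor>Q * q * t\<rfloor>"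
  define M where "M = F div int p ^ (2 * k + 1)"
  have pos: "Q > 0" "q > 0" using p by (simp_all add: Q_def q_def)
  have Qq: "real p ^ (Suc k)\<^sup>2 = Q * q" by (simp only: power_Suc_square Q_def q_def)
  have "block_digit p t k = F mod int p ^ (2 * k + 1)"
    using t Qq by (simp add: block_digit_def F_def)
  then have digit: "real_of_int (block_digit p t k) = of_int F - q * of_int M"
    by (simp add: M_def q_def flip: minus_mult_div_eq_mod)
  have "padic_of p t ((Suc k)\<^sup>2) = s + block_digit p t k * int p ^ k\<^sup>2"
    by (simp add: padic_of_square p t s_def del: power_Suc)
  then have x: "real_of_int (padic_of p t ((Suc k)\<^sup>2)) = of_int s + (of_int F - q * of_int M) * Q"
    by (simp add: digit Q_def)
  \<comment> \<open>This is the phase of the coupled character modulo 1. The contributions of block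
    \<open>k\<close> cancel; what remains are the lower blocks \<open>s\<close> of the p-adic part
    and the digits of \<open>t\<close> beyond position (k + 1)^2. Both terms in the numerator lie in
    [0, 1].\<close>
  define \<theta> where "\<theta> = (of_int s / Q - (Q * q * t - of_int F)) / q"
  have "2 * pi * of_int (padic_of p t ((Suc k)\<^sup>2)) / (Q * q) + 2 * pi * of_int (- (int p ^ k\<^sup>2)) * t
      = 2 * pi * \<theta> - 2 * pi * of_int M"
    using pos unfolding x \<theta>_def by (simp add: Q_def[symmetric] field_simps)
  then have "coupled_char p k (padic_of p t, circle_proj t) = cis (2 * pi * \<theta> - 2 * pi * of_int M)"
    by (simp only: coupled_char_def padic_char_def fst_conv snd_conv circle_char_proj cis_mult Qq)
  also have "\<dots> = cis (2 * pi * \<theta>)"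
    by (simp add: cis_multiple_2pi flip: cis_divide)
  finally have eq: "coupled_char p k (padic_of p t, circle_proj t) = cis (2 * pi * \<theta>)" .
  have "0 \<le> s" "s \<le> int p ^ k\<^sup>2"
    using digit_sum_bounds[OF p t(1), of k] by (simp_all add: s_def padic_of_square p t)
  then have "0 \<le> s" "real_of_int s \<le> real_of_int (int p ^ k\<^sup>2)"
    by (simp_all only: of_int_le_iff)
  then have "0 \<le> of_int s / Q" "of_int s / Q \<le> 1"
    using pos by (simp_all add: Q_def)
  moreover have "0 \<le> Q * q * t - of_int F" "Q * q * t - of_int F \<le> 1"
    unfolding F_def by linarith+
  ultimately have "\<bar>of_int s / Q - (Q * q * t - of_int F)\<bar> \<le> 1" by linarith
  then have "\<bar>\<theta>\<bar> \<le> 1 / q"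
    using pos by (simp add: \<theta>_def divide_right_mono)
  then have "\<bar>2 * pi * \<theta>\<bar> \<le> 2 * pi * (1 / q)"
    using mult_left_mono[of "\<bar>\<theta>\<bar>" "1 / q" "2 * pi"] by (simp add: abs_mult)
  then show ?thesis
    using norm_one_minus_cis[of "2 * pi * \<theta>"] by (simp add: eq q_def)
qed

lemma coupled_char_mult:
  assumes p: "p > 0" and "z \<in> carrier (padic_group p \<times>\<times> circle_group)" "w \<in> carrier (padic_group p \<times>\<times> circle_group)"
  shows "coupled_char p k (z \<otimes>\<^bsub>padic_group p \<times>\<times> circle_group\<^esub> w) = coupled_char p k z * coupled_char p k w"
proof -
  obtain s t where "snd z = circle_proj s" "snd w = circle_proj t"
    using assms by (auto simp: carrier_circle_group mem_Times_iff)
  moreover have "circle_char n (circle_proj (s + t)) = circle_char n (circle_proj s) * circle_char n (circle_proj t)" for n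
    by (simp add: circle_char_proj cis_mult distrib_left)
  ultimately show ?thesis
    by (simp add: coupled_char_def mult_DirProd' padic_char_mult[OF p] circle_proj_mult)
qed

lemma norm_coupled_char: "cmod (coupled_char p k z) = 1"
  by (simp add: coupled_char_def padic_char_def circle_char_def norm_mult)

text \<open>For negative \<open>t\<close> the point is the inverse of the one at \<open>- t\<close>;
  inverting a complex number of modulus 1 preserves its distance from 1.\<close>

lemma coupled_char_near_1:
  assumes p: "prime p" and t: "-1 < t" "t < 1"
  shows "cmod (1 - coupled_char p k (padic_of p t, circle_proj t)) \<le> 2 * pi / real p ^ (2 * k + 1)"
proof (cases "0 \<le> t")
  case True
  then show ?thesis using coupled_char_near_1_nonneg prime_gt_0_nat[OF p] t by blast
next
  case False
  let ?f = "coupled_char p k" and ?z = "(padic_of p t, circle_proj t)"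
    and ?w = "(padic_of p (- t), circle_proj (- t))" and ?G = "padic_group p \<times>\<times> circle_group"
  have p0: "p > 0" by (rule prime_gt_0_nat[OF p])
  interpret P: compact_group "padic_group p" "padic_topology p" by (rule padic_compact_group[OF p])
  interpret C: compact_group circle_group circle_topology by (rule circle_compact_group)
  interpret group ?G by (rule DirProd_group) unfold_locales
  have z: "?z \<in> carrier ?G" "?w \<in> carrier ?G"
    using padic_of_digits_carrier[OF p0] by (auto simp: carrier_circle_group)
  have "?w = inv\<^bsub>?G\<^esub> ?z"
    using z by (simp add: inv_DirProd[OF P.is_group C.is_group] padic_of_uminus[OF p] circle_proj_inv)
  then have "?w \<otimes>\<^bsub>?G\<^esub> ?z = \<one>\<^bsub>?G\<^esub>" using z by simp
  moreover have "?f \<one>\<^bsub>?G\<^esub> = 1"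
  proof -
    have "?f \<one>\<^bsub>?G\<^esub> = ?f \<one>\<^bsub>?G\<^esub> * ?f \<one>\<^bsub>?G\<^esub>"
      using coupled_char_mult[OF p0 one_closed one_closed, of k] by (metis one_closed r_one)
    moreover have "?f \<one>\<^bsub>?G\<^esub> \<noteq> 0"
      using norm_coupled_char[of p k "\<one>\<^bsub>?G\<^esub>"] by auto
    ultimately show ?thesis by simp
  qed
  ultimately have "?f ?w * ?f ?z = 1"
    using coupled_char_mult[OF p0 z(2,1), of k] by metis
  then have "1 - ?f ?z = - (1 - ?f ?w) * ?f ?z"
    by (simp add: algebra_simps)
  then have "cmod (1 - ?f ?z) = cmod (1 - ?f ?w)"
    by (simp add: norm_mult norm_minus_commute norm_coupled_char)
  also have "\<dots> \<le> 2 * pi / real p ^ (2 * k + 1)"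
    using False t by (intro coupled_char_near_1_nonneg p0) auto
  finally show ?thesis .
qed

section \<open>Symmetry of the coupling and failure of its spectral gap\<close>

lemma (in abelian_compact_group) symmetric_borel_prob_odd:
  assumes F: "F \<in> borel \<rightarrow>\<^sub>M borel_of T" and odd: "\<And>t. F (- t) = inv (F t)"
  shows "symmetric_borel_prob G T (distr unif (borel_of T) F)"
proof -
  have "distr (distr unif (borel_of T) F) (borel_of T) (\<lambda>x. inv x) = distr unif (borel_of T) (\<lambda>t. F (- t))"
    using F measurable_inv by (simp add: distr_distr o_def odd)
  \<comment> \<open>The inversion on the group has been moved to a reflection of the parameter,
    under which \<open>unif\<close> is invariant.\<close>
  also have "\<dots> = distr (distr unif borel uminus) (borel_of T) F"
    using F by (simp add: distr_distr o_def)
  also have "\<dots> = distr unif (borel_of T) F"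
    by (simp only: distr_unif_uminus)
  finally show ?thesis
    using F by (simp add: symmetric_borel_prob_def prob_space.prob_space_distr[OF prob_space_unif])
qed

lemma measurable_coupling:
  assumes "p > 0"
  shows "(\<lambda>t. (padic_of p t, circle_proj t)) \<in> borel \<rightarrow>\<^sub>M borel_of (prod_topology (padic_topology p) circle_topology)"
proof -
  interpret C: abelian_compact_group circle_group circle_topology by (rule circle_abelian_compact_group)
  show ?thesis
    using measurable_Pair[OF measurable_padic_of[OF assms] measurable_circle_proj]
    by (simp add: measurable_cong_sets[OF refl sets_borel_of_prod[OF second_countable_padic C.second_countable]])
qed

lemma measurable_coupled_char:
  "coupled_char p k \<in> borel_measurable (borel_of (prod_topology (padic_topology p) circle_topology))"
  unfolding coupled_char_def[abs_def]
  by (intro borel_measurable_times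
      measurable_compose[OF measurable_continuous_map[OF continuous_map_fst] measurable_padic_char]
      measurable_compose[OF measurable_continuous_map[OF continuous_map_snd] measurable_circle_char])

text \<open>The coupled characters are uniformly close to 1 on (-1, 1), so their integrals bound the
  operator norm below by 1 - 2 pi / p^(2 k + 1) for every \<open>k\<close>; no bound below 1 is
  possible.\<close>

lemma coupling_no_spectral_gap:
  assumes p: "prime p"
  defines "P \<equiv> prod_topology (padic_topology p) circle_topology"
  shows "\<not> spectral_gap (padic_group p \<times>\<times> circle_group) P
    (distr unif (borel_of P) (\<lambda>t. (padic_of p t, circle_proj t)))"
proof
  let ?G = "padic_group p \<times>\<times> circle_group" and ?Z = "\<lambda>t. (padic_of p t, circle_proj t)"
  let ?\<nu> = "distr unif (borel_of P) ?Z"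
  have p0: "p > 0" by (rule prime_gt_0_nat[OF p])
  interpret U: prob_space unif by (rule prob_space_unif)
  interpret A: abelian_compact_group "padic_group p" "padic_topology p"
    by (rule padic_abelian_compact_group[OF p])
  interpret C: abelian_compact_group circle_group circle_topology by (rule circle_abelian_compact_group)
  interpret D: abelian_compact_group ?G P
    unfolding P_def by (rule abelian_compact_group_DirProd; unfold_locales)
  have Z: "?Z \<in> unif \<rightarrow>\<^sub>M borel_of P"
    using measurable_coupling[OF p0] by (simp add: P_def)
  have fm: "coupled_char p k \<in> borel_measurable (borel_of P)" for k
    using measurable_coupled_char by (simp add: P_def)
  have digits: "(\<lambda>t j. discrete (block_digit p t j)) \<in> borel_measurable unif"
    using measurable_block_digit[of p] by simp
  \<comment> \<open>An explicit Haar measure shows that the choice in \<open>haar_prob\<close> is a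
    genuine one. The p-adic factor enters through its digit sequences, where the map is
    continuous.\<close>
  have "\<exists>m. is_haar_prob ?G P m"
    unfolding P_def
    by (rule exI, rule is_haar_prob_DirProd[OF A.abelian_compact_group_axioms C.abelian_compact_group_axioms
          U.prob_space_distr[OF digits] _ continuous_padic_of_digits[OF p0]
          prob_space_unif sets_unif continuous_circle_proj is_haar_prob_padic_of(2)[OF p] is_haar_prob_circle]) simp
  then have m: "is_haar_prob ?G P (haar_prob ?G P)"
    unfolding haar_prob_def by (rule someI_ex)
  let ?N = "op_norm_on (haar_prob ?G P) (constants_perp (haar_prob ?G P)) (averaging_op ?G ?\<nu>)"
  have lower: "ereal (1 - 2 * pi / real p ^ (2 * k + 1)) \<le> ?N" for k
  proof -
    let ?f = "coupled_char p k"
    \<comment> \<open>Half a period of the circle factor, where the character takes the value -1;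
      this witnesses that it is nontrivial.\<close>
    let ?z = "(\<one>\<^bsub>padic_group p\<^esub>, circle_proj (1 / (2 * real p ^ k\<^sup>2)))"
    have "ereal (cmod (LINT x|?\<nu>. ?f x)) \<le> ?N"
    proof (rule D.op_norm_ge_character[OF m])
      show "prob_space ?\<nu>" using Z by (rule U.prob_space_distr)
      show "?z \<in> carrier ?G" by (simp add: carrier_circle_group flip: carrier_padic)
      have "?f ?z = cis (- pi)"
        using p0 by (simp add: coupled_char_def padic_char_def circle_char_proj) (simp add: padic_group_def)
      then show "?f ?z \<noteq> 1" by (simp add: complex_eq_iff)
    qed (use norm_coupled_char coupled_char_mult[OF p0] fm in auto)
    moreover have "(LINT x|?\<nu>. ?f x) = (LINT t|unif. ?f (?Z t))"
      using Z fm by (rule integral_distr)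
    moreover have "cmod (1 - (LINT t|unif. ?f (?Z t))) \<le> 2 * pi / real p ^ (2 * k + 1)"
    proof -
      have int: "integrable unif (\<lambda>t. ?f (?Z t))"
        using measurable_compose[OF Z fm] norm_coupled_char
        by (intro U.integrable_const_bound[where B = 1]) auto
      have "AE t in unif. t \<in> {-1<..<1}"
        unfolding unif_def by (rule AE_uniform_measureI) auto
      then have ae: "AE t in unif. cmod (1 - ?f (?Z t)) \<le> 2 * pi / real p ^ (2 * k + 1)"
        by eventually_elim (use coupled_char_near_1[OF p] in auto)
      have "1 - (LINT t|unif. ?f (?Z t)) = (LINT t|unif. 1 - ?f (?Z t))"
        using int U.prob_space by simp
      then have "cmod (1 - (LINT t|unif. ?f (?Z t))) \<le> (LINT t|unif. cmod (1 - ?f (?Z t)))"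
        by simp
      also have "\<dots> \<le> (LINT t|unif. 2 * pi / real p ^ (2 * k + 1))"
        using int ae by (intro integral_mono_AE) auto
      finally show ?thesis using U.prob_space by simp
    qed
    \<comment> \<open>Turns closeness of the integral to 1 into a lower bound for its
      modulus.\<close>
    moreover have "1 \<le> cmod c + cmod (1 - c)" for c :: complex
      using norm_triangle_ineq[of c "1 - c"] by simp
    ultimately have "1 - 2 * pi / real p ^ (2 * k + 1) \<le> cmod (LINT x|?\<nu>. ?f x)"
      by (smt (verit))
    then show ?thesis
      using \<open>ereal (cmod (LINT x|?\<nu>. ?f x)) \<le> ?N\<close> order_trans ereal_less_eq(3) by blast
  qed
  assume "spectral_gap ?G P ?\<nu>"
  then have "?N < 1" by (simp add: spectral_gap_def)
  then obtain r where r: "?N < ereal r" "ereal r < 1"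
    using ereal_dense2 by blast
  have "(\<lambda>k. 1 - 2 * pi * (1 / real p) ^ (2 * k + 1)) \<longlonglongrightarrow> 1 - 2 * pi * 0"
  proof (intro tendsto_intros)
    have "(\<lambda>n. (1 / real p) ^ n) \<longlonglongrightarrow> 0"
      using prime_ge_2_nat[OF p] by (intro LIMSEQ_realpow_zero) auto
    then show "(\<lambda>k. (1 / real p) ^ (2 * k + 1)) \<longlonglongrightarrow> 0"
      by (rule filterlim_compose) (auto intro!: filterlim_subseq strict_monoI)
  qed
  then have "\<forall>\<^sub>F k in sequentially. r < 1 - 2 * pi * (1 / real p) ^ (2 * k + 1)"
    using r(2) by (intro order_tendstoD(1)) auto
  then obtain k where "r < 1 - 2 * pi * (1 / real p) ^ (2 * k + 1)"
    using eventually_happens'[OF sequentially_bot] by blast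
  then have "r < 1 - 2 * pi / real p ^ (2 * k + 1)"
    by (simp add: power_divide)
  then show False
    using r(1) lower[of k] by (meson ereal_less_eq(3) less_imp_le not_le order_trans)
qed

theorem theorem60:
  fixes p :: nat
  assumes "prime p"
  shows "\<not> spectrally_independent (padic_group p) (padic_topology p) circle_group circle_topology"
proof
  let ?G = "padic_group p" and ?S = "padic_topology p" and ?H = circle_group and ?T = circle_topology
  let ?P = "prod_topology ?S ?T" and ?Z = "\<lambda>t. (padic_of p t, circle_proj t)"
  \<comment> \<open>The probability space must live on the product type, so the joint law itself is
    used, with the two projections as random variables.\<close>
  let ?M = "distr unif (borel_of ?P) ?Z"
  have p0: "p > 0" by (rule prime_gt_0_nat[OF assms])
  interpret U: prob_space unif by (rule prob_space_unif)
  interpret A: abelian_compact_group ?G ?S by (rule padic_abelian_compact_group[OF assms])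
  interpret C: abelian_compact_group ?H ?T by (rule circle_abelian_compact_group)
  interpret D: abelian_compact_group "?G \<times>\<times> ?H" ?P
    by (rule abelian_compact_group_DirProd; unfold_locales)
  have Z: "?Z \<in> unif \<rightarrow>\<^sub>M borel_of ?P"
    using measurable_coupling[OF p0] by simp
  have M: "prob_space ?M" using Z by (rule U.prob_space_distr)
  have fst: "fst \<in> borel_of ?P \<rightarrow>\<^sub>M borel_of ?S" and snd: "snd \<in> borel_of ?P \<rightarrow>\<^sub>M borel_of ?T"
    by (rule measurable_continuous_map continuous_map_fst continuous_map_snd)+
  have X: "distr ?M (borel_of ?S) fst = distr unif (borel_of ?S) (padic_of p)"
    using Z fst by (simp add: distr_distr o_def)
  have Y: "distr ?M (borel_of ?T) snd = distr unif (borel_of ?T) circle_proj"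
    using Z snd by (simp add: distr_distr o_def)
  have odd: "?Z (- t) = inv\<^bsub>?G \<times>\<times> ?H\<^esub> ?Z t" for t
    using padic_of_digits_carrier[OF p0]
    by (simp add: inv_DirProd[OF A.is_group C.is_group] carrier_circle_group
        padic_of_uminus[OF assms] circle_proj_inv)
  \<comment> \<open>The pair of the two projections is the identity, so its law under
    \<open>?M\<close> is \<open>?M\<close>.\<close>
  have id: "distr ?M (borel_of ?P) (\<lambda>z. z) = ?M"
    using Z by (simp add: distr_distr o_def)
  assume "spectrally_independent ?G ?S ?H ?T"
  moreover have "symmetric_rv (?G \<times>\<times> ?H) ?P ?M (\<lambda>z. (fst z, snd z))"
    using D.symmetric_borel_prob_odd[OF measurable_coupling[OF p0] odd] M
    by (simp add: symmetric_rv_def id)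
  moreover have "spectral_gap_rv ?G ?S ?M fst"
    using A.spectral_gap_haar[OF is_haar_prob_padic_of(1)[OF assms]]
      A.symmetric_borel_prob_odd[OF measurable_padic_of[OF p0] padic_of_uminus[OF assms]] M fst
    by (simp add: spectral_gap_rv_def symmetric_rv_def X)
  moreover have "spectral_gap_rv ?H ?T ?M snd"
    using C.spectral_gap_haar[OF is_haar_prob_circle]
      C.symmetric_borel_prob_odd[OF measurable_circle_proj circle_proj_inv[symmetric]] M snd
    by (simp add: spectral_gap_rv_def symmetric_rv_def Y)
  ultimately have "spectral_gap_rv (?G \<times>\<times> ?H) ?P ?M (\<lambda>z. (fst z, snd z))"
    unfolding spectrally_independent_def by blast
  then have "spectral_gap (?G \<times>\<times> ?H) ?P ?M"
    by (simp add: spectral_gap_rv_def id)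
  then show False
    using coupling_no_spectral_gap[OF assms] by simp
qed

end
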